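(* Let $\mathcal S$ be a densely defined closed symmetric operator in a Hilbert space $\mathcal H$. Assume that $\mathcal H$ is a subspace of a Hilbert space $\mathfrak H$, put $\mathcal H_1:=\mathfrak H\ominus\mathcal H$, and assume $\dim\mathcal H_1=\infty$. If the deficiency indices of $\mathcal S$ satisfy $n_\pm=\infty$, then in $\mathfrak H$ there exist: (1) selfadjoint extensions $\widetilde{\mathcal S}$ of $\mathcal S$ such that $$\operatorname{dom}\widetilde{\mathcal S}\cap\mathcal H=\operatorname{dom}\mathcal S\quad\text{and}\quad\operatorname{dom}\widetilde{\mathcal S}\cap\mathcal H_1=\{0\};$$ (2) maximal dissipative extensions $\widetilde{\mathcal S}$ of $\mathcal S$ such that $$\operatorname{dom}\widetilde{\mathcal S}\cap\mathcal H=\operatorname{dom}\widetilde{\mathcal S}^*\cap\mathcal H=\operatorname{dom}\mathcal S\quad\text{and}\quad\operatorname{dom}\widetilde{\mathcal S}\cap\mathcal H_1=\operatorname{dom}\widetilde{\mathcal S}^*\cap\mathcal H_1=\{0\}.$$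
   Context: All Hilbert spaces are complex and separable (so infinite dimension means countably infinite); "subspace" means closed linear manifold. The deficiency indices of $\mathcal S$ are $n_\pm=\dim\big(\mathcal H\ominus\operatorname{ran}(\mathcal S\pm iI)\big)$. An operator $T$ is dissipative if $\operatorname{Im}(Tf,f)\ge0$ for all $f\in\operatorname{dom}T$, and maximal dissipative if it is dissipative and has no proper dissipative extension in the same space. *)

theory Defs
  imports "HOL-Analysis.Analysis" "HOL-Library.Extended_Nat"
begin

section \<open>Complex Hilbert spaces\<close>

text \<open>
  A complex inner product space is a real one whose real inner product is the real part of a
  sesquilinear form; norm and topology are thus those of the library. The form is linear in the
  first argument (this fixes the sign in the notion of a dissipative operator). Positive
  definiteness comes from \<^class>\<open>real_inner\<close>. Separability is not part of the class; it is imposed by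
  the sort \<^class>\<open>second_countable_topology\<close>, which for metric spaces is the same as separability.
\<close>

class complex_inner = real_inner +
  fixes scaleC :: "complex \<Rightarrow> 'a \<Rightarrow> 'a"  (infixr "*\<^sub>C" 75)
    and cinner :: "'a \<Rightarrow> 'a \<Rightarrow> complex"
  assumes scaleC_add_right: "c *\<^sub>C (x + y) = c *\<^sub>C x + c *\<^sub>C y"
    and scaleC_add_left: "(c + d) *\<^sub>C x = c *\<^sub>C x + d *\<^sub>C x"
    and scaleC_scaleC: "c *\<^sub>C d *\<^sub>C x = (c * d) *\<^sub>C x"
    and scaleR_eq_scaleC: "r *\<^sub>R x = complex_of_real r *\<^sub>C x"
    and cinner_add_left: "cinner (x + y) z = cinner x z + cinner y z"
    and cinner_scaleC_left: "cinner (c *\<^sub>C x) y = c * cinner x y"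
    and cinner_commute: "cinner x y = cnj (cinner y x)"
    and inner_eq_Re_cinner: "inner x y = Re (cinner x y)"

class complex_hilbert = complex_inner + complete_space

lemma scaleC_one: "1 *\<^sub>C x = (x :: 'a :: complex_inner)"
  using scaleR_eq_scaleC[of 1 x] by simp

global_interpretation complex_vector: vector_space "scaleC :: complex \<Rightarrow> 'a \<Rightarrow> 'a :: complex_inner"
  defines csubspace = complex_vector.subspace
    and cspan = complex_vector.span
    and cdim = complex_vector.dim
  by unfold_locales (simp_all add: scaleC_add_right scaleC_add_left scaleC_scaleC scaleC_one)

definition closed_csubspace :: "'a :: complex_inner set \<Rightarrow> bool"
  where "closed_csubspace M \<longleftrightarrow> csubspace M \<and> closed M"

definition orth_diff :: "'a :: complex_inner set \<Rightarrow> 'a set \<Rightarrow> 'a set"  (infixl "\<ominus>" 65)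
  where "K \<ominus> M = {x \<in> K. \<forall>m\<in>M. cinner x m = 0}"

text \<open>
  The Hilbert dimension. In a separable space there is only one infinite dimension, so extended
  naturals suffice; a finite Hilbert dimension is the algebraic one.
\<close>

definition hdim :: "'a :: complex_inner set \<Rightarrow> enat"
  where "hdim M = (if \<exists>B. finite B \<and> M \<subseteq> cspan B then enat (cdim M) else \<infinity>)"

section \<open>Unbounded operators\<close>

text \<open>
  An operator is identified with its graph: its domain is \<^const>\<open>Domain\<close>, its range
  \<^const>\<open>Range\<close>, extension is inclusion, and an operator is closed iff its graph is \<^const>\<open>closed\<close>.
  The argument \<open>K\<close> is the Hilbert space (a closed subspace of the ambient type) in which the
  operator acts. Domains need not be dense.
\<close>

type_synonym 'a operator = "('a \<times> 'a) set"

definition operator_in :: "'a :: complex_inner set \<Rightarrow> 'a operator \<Rightarrow> bool"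
  where "operator_in K T \<longleftrightarrow> T \<subseteq> K \<times> K \<and> single_valued T \<and> (0, 0) \<in> T \<and>
    (\<forall>(f, g)\<in>T. \<forall>(f', g')\<in>T. (f + f', g + g') \<in> T) \<and>
    (\<forall>c. \<forall>(f, g)\<in>T. (c *\<^sub>C f, c *\<^sub>C g) \<in> T)"

definition densely_defined_in :: "'a :: complex_inner set \<Rightarrow> 'a operator \<Rightarrow> bool"
  where "densely_defined_in K T \<longleftrightarrow> K \<subseteq> closure (Domain T)"

definition symmetric :: "'a :: complex_inner operator \<Rightarrow> bool"
  where "symmetric T \<longleftrightarrow> (\<forall>(f, g)\<in>T. \<forall>(f', g')\<in>T. cinner g f' = cinner f g')"

text \<open>The adjoint is itself (the graph of) an operator exactly if \<open>T\<close> is densely defined in \<open>K\<close>.\<close>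

definition adjoint_in :: "'a :: complex_inner set \<Rightarrow> 'a operator \<Rightarrow> 'a operator"
  where "adjoint_in K T = {(h, k) \<in> K \<times> K. \<forall>(f, g)\<in>T. cinner g h = cinner f k}"

definition selfadjoint_in :: "'a :: complex_inner set \<Rightarrow> 'a operator \<Rightarrow> bool"
  where "selfadjoint_in K T \<longleftrightarrow>
    operator_in K T \<and> densely_defined_in K T \<and> adjoint_in K T = T"

definition dissipative_in :: "'a :: complex_inner set \<Rightarrow> 'a operator \<Rightarrow> bool"
  where "dissipative_in K T \<longleftrightarrow> operator_in K T \<and> (\<forall>(f, g)\<in>T. Im (cinner g f) \<ge> 0)"

definition maximal_dissipative_in :: "'a :: complex_inner set \<Rightarrow> 'a operator \<Rightarrow> bool"
  where "maximal_dissipative_in K T \<longleftrightarrow>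
    dissipative_in K T \<and> (\<nexists>T'. dissipative_in K T' \<and> T \<subset> T')"

definition add_scalar :: "'a :: complex_inner operator \<Rightarrow> complex \<Rightarrow> 'a operator"
  where "add_scalar T c = {(f, g + c *\<^sub>C f) |f g. (f, g) \<in> T}"

definition deficiency_plus :: "'a :: complex_inner set \<Rightarrow> 'a operator \<Rightarrow> enat"
  where "deficiency_plus K T = hdim (K \<ominus> Range (add_scalar T \<i>))"

definition deficiency_minus :: "'a :: complex_inner set \<Rightarrow> 'a operator \<Rightarrow> enat"
  where "deficiency_minus K T = hdim (K \<ominus> Range (add_scalar T (- \<i>)))"

end

theory Submission
  imports Defs
begin

text \<open>
  By the Cayley transform, a selfadjoint extension of \<open>S\<close> in the large space is a unitary map from
  \<open>K\<^sub>+ \<oplus> H\<^sub>1\<close> onto \<open>K\<^sub>- \<oplus> H\<^sub>1\<close>, where \<open>K\<^sub>+\<close> and \<open>K\<^sub>-\<close> are the deficiency subspaces of \<open>S\<close>.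
  All three spaces are infinite-dimensional and separable, so they may be identified; in the rotated
  coordinates \<open>x + z\<close>, \<open>x - z\<close> of \<open>H\<^sub>1 \<oplus> H\<^sub>1\<close> take the unitary to be the direct sum of the maps
  \<open>(1 - \<i>P)(1 + \<i>P)\<inverse>\<close> and \<open>(1 - \<i>Q)(1 + \<i>Q)\<inverse>\<close> for symmetric injective operators \<open>P\<close> and \<open>Q\<close>. Both
  intersection conditions then reduce to \<open>ran P \<inter> ran Q = {0}\<close>. A selfadjoint operator is maximal
  dissipative and equal to its adjoint, so it also serves for the second claim.
\<close>

section \<open>Complex inner products\<close>

instance complex_hilbert \<subseteq> banach ..

abbreviation clinear :: "('a::complex_inner \<Rightarrow> 'b::complex_inner) \<Rightarrow> bool"
  where "clinear \<equiv> Vector_Spaces.linear scaleC scaleC"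

lemma cinner_add_right: "cinner x (y + z) = cinner x y + cinner x z"
  by (metis cinner_add_left cinner_commute complex_cnj_add)

lemma cinner_scaleC_right: "cinner x (c *\<^sub>C y) = cnj c * cinner x y"
  by (metis cinner_scaleC_left cinner_commute complex_cnj_mult)

lemma cinner_zero_left [simp]: "cinner 0 y = 0"
  using cinner_add_left[of 0 0 y] by simp

lemma cinner_zero_right [simp]: "cinner y 0 = 0"
  using cinner_add_right[of y 0 0] by simp

lemma cinner_minus_left: "cinner (- x) y = - cinner x y"
  using cinner_add_left[of x "- x" y] by (simp add: add_eq_0_iff)

lemma cinner_minus_right: "cinner x (- y) = - cinner x y"
  using cinner_add_right[of x y "- y"] by (simp add: add_eq_0_iff)

lemma cinner_diff_left: "cinner (x - y) z = cinner x z - cinner y z"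
  using cinner_add_left[of x "- y" z] by (simp add: cinner_minus_left)

lemma cinner_diff_right: "cinner x (y - z) = cinner x y - cinner x z"
  using cinner_add_right[of x y "- z"] by (simp add: cinner_minus_right)

lemmas cinner_simps = cinner_add_left cinner_add_right cinner_diff_left cinner_diff_right
  cinner_minus_left cinner_minus_right cinner_scaleC_left cinner_scaleC_right

lemma cinner_sum_left: "cinner (sum f A) y = (\<Sum>i\<in>A. cinner (f i) y)"
  by (induction A rule: infinite_finite_induct) (auto simp: cinner_add_left)

lemma cinner_sum_right: "cinner y (sum f A) = (\<Sum>i\<in>A. cinner y (f i))"
  by (induction A rule: infinite_finite_induct) (auto simp: cinner_add_right)

lemma cinner_self: "cinner x x = complex_of_real ((norm x)\<^sup>2)"
proof -
  have "Im (cinner x x) = 0"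
    by (metis cinner_commute complex_cnj_cancel_iff complex_eq_iff cnj.sel(2) neg_equal_zero)
  then show ?thesis
    by (simp add: complex_eq_iff power2_norm_eq_inner inner_eq_Re_cinner)
qed

lemma cinner_self_eq_0 [simp]: "cinner x x = 0 \<longleftrightarrow> x = 0"
  by (simp add: cinner_self)

lemma norm_scaleC: "norm (c *\<^sub>C x) = norm c * norm x"
proof -
  have "complex_of_real ((norm (c *\<^sub>C x))\<^sup>2) = c * cnj c * complex_of_real ((norm x)\<^sup>2)"
    unfolding cinner_self[symmetric] by (simp add: cinner_simps)
  also have "\<dots> = complex_of_real ((norm c * norm x)\<^sup>2)"
    by (simp add: complex_norm_square[symmetric] power_mult_distrib)
  finally show ?thesis
    by (simp only: of_real_eq_iff power2_eq_iff_nonneg norm_ge_zero zero_le_mult_iff) simp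
qed

text \<open>Multiplying \<open>x\<close> by a unimodular scalar makes \<open>cinner x y\<close> real
  and nonnegative, hence equal to the real inner product, to which the real Cauchy-Schwarz
  inequality applies.\<close>

lemma cinner_norm_le: "norm (cinner x y) \<le> norm x * norm y"
proof (cases "cinner x y = 0")
  case False
  define c where "c = cnj (sgn (cinner x y))"
  have [simp]: "norm c = 1"
    using False by (simp add: c_def norm_sgn)
  have "c * cinner x y = complex_of_real (norm (cinner x y))"
    using False
    by (simp add: c_def sgn_div_norm scaleR_conv_of_real complex_norm_square[symmetric]
        field_simps power2_eq_square)
  then have "norm (cinner x y) = inner (c *\<^sub>C x) y"
    by (simp add: inner_eq_Re_cinner cinner_scaleC_left)
  also have "\<dots> \<le> norm (c *\<^sub>C x) * norm y"
    by (rule norm_cauchy_schwarz)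
  finally show ?thesis
    by (simp add: norm_scaleC)
qed simp

lemma bounded_bilinear_cinner: "bounded_bilinear cinner"
  by standard
    (auto simp: cinner_simps scaleR_eq_scaleC scaleR_conv_of_real intro!: exI[of _ 1] cinner_norm_le)

lemmas cinner_sums_left = bounded_linear.sums[OF bounded_bilinear.bounded_linear_left[OF bounded_bilinear_cinner]]
  and cinner_sums_right = bounded_linear.sums[OF bounded_bilinear.bounded_linear_right[OF bounded_bilinear_cinner]]
  and tendsto_cinner = bounded_bilinear.tendsto[OF bounded_bilinear_cinner]
  and continuous_on_cinner = bounded_bilinear.continuous_on[OF bounded_bilinear_cinner]

lemma bounded_bilinear_scaleC: "bounded_bilinear scaleC"
  by standard
    (auto simp: scaleC_add_left scaleC_add_right scaleR_eq_scaleC scaleC_scaleC scaleR_conv_of_real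
      norm_scaleC mult.commute intro!: exI[of _ 1])

lemmas scaleC_sums_right = bounded_linear.sums[OF bounded_bilinear.bounded_linear_right[OF bounded_bilinear_scaleC]]
  and bounded_linear_scaleC = bounded_bilinear.bounded_linear_right[OF bounded_bilinear_scaleC]

section \<open>Closed subspaces, orthogonal complements and complex linear maps\<close>

lemma csubspace_closure:
  assumes "csubspace M"
  shows "csubspace (closure M)"
proof (rule complex_vector.subspaceI)
  show "0 \<in> closure M"
    using assms closure_subset complex_vector.subspace_0 by blast
  show "x + y \<in> closure M" if xy: "x \<in> closure M" "y \<in> closure M" for x y
  proof -
    obtain f g where f: "\<And>n. f n \<in> M" "f \<longlonglongrightarrow> x" and g: "\<And>n. g n \<in> M" "g \<longlonglongrightarrow> y"
      using xy unfolding closure_sequential by metis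
    then have "\<And>n. f n + g n \<in> M"
      using assms by (simp add: complex_vector.subspace_add)
    then show ?thesis
      using tendsto_add[OF f(2) g(2)] unfolding closure_sequential
      by (intro exI[of _ "\<lambda>n. f n + g n"]) simp
  qed
  fix c x assume "x \<in> closure M"
  moreover have "scaleC c ` closure M \<subseteq> closure (scaleC c ` M)"
    by (rule closure_bounded_linear_image_subset[OF bounded_linear_scaleC])
  moreover have "closure (scaleC c ` M) \<subseteq> closure M"
    using assms by (intro closure_mono) (auto simp: complex_vector.subspace_scale)
  ultimately show "c *\<^sub>C x \<in> closure M"
    by blast
qed

lemma csubspace_orth_diff: "csubspace K \<Longrightarrow> csubspace (K \<ominus> M)"
  by (auto simp: complex_vector.subspace_def orth_diff_def cinner_simps)

lemma closed_csubspace_orth_diff: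
  assumes "closed_csubspace K"
  shows "closed_csubspace (K \<ominus> M)"
proof -
  have "K \<ominus> M = K \<inter> (\<Inter>m\<in>M. {x. cinner x m = 0})"
    by (auto simp: orth_diff_def)
  moreover have "closed (\<Inter>m\<in>M. {x. cinner x m = 0})"
    by (intro closed_INT ballI closed_Collect_eq continuous_on_cinner continuous_intros)
  ultimately show ?thesis
    using assms csubspace_orth_diff[of K M] by (simp add: closed_csubspace_def closed_Int)
qed

lemma orthogonal_to_dense:
  assumes "K \<subseteq> closure D" "x \<in> K" "\<And>y. y \<in> D \<Longrightarrow> cinner x y = 0"
  shows "x = 0"
proof -
  have "closed {y. cinner x y = 0}"
    by (intro closed_Collect_eq continuous_on_cinner continuous_intros)
  then have "closure D \<subseteq> {y. cinner x y = 0}"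
    using assms(3) by (intro closure_minimal) auto
  then have "cinner x x = 0"
    using assms by blast
  then show ?thesis by simp
qed

lemma clinearI:
  assumes "\<And>x y. f (x + y) = f x + f y" "\<And>c x. f (c *\<^sub>C x) = c *\<^sub>C f x"
  shows "clinear f"
  by unfold_locales (simp_all add: assms)

lemma clinear_simps:
  assumes "clinear f"
  shows "f (x + y) = f x + f y" "f (x - y) = f x - f y" "f (c *\<^sub>C x) = c *\<^sub>C f x"
    "f (- x) = - f x" "f 0 = 0"
proof -
  interpret Vector_Spaces.linear scaleC scaleC f
    by (rule assms)
  show "f (x + y) = f x + f y" "f (x - y) = f x - f y" "f (c *\<^sub>C x) = c *\<^sub>C f x"
    "f (- x) = - f x" "f 0 = 0"
    by (simp_all add: add diff scale neg)
qed

section \<open>Orthonormal sequences\<close>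

text \<open>Zero entries are admitted, so that finite-dimensional subspaces are covered too.\<close>

definition orthonormal_seq :: "(nat \<Rightarrow> 'a::complex_inner) \<Rightarrow> bool"
  where "orthonormal_seq e \<longleftrightarrow>
    (\<forall>i j. i \<noteq> j \<longrightarrow> cinner (e i) (e j) = 0) \<and> (\<forall>i. e i = 0 \<or> norm (e i) = 1)"

text \<open>Completeness is expressed by a trivial orthogonal complement in \<open>M\<close>; for
  closed \<open>M\<close> in a complete space, convergent expansions are derived from it in
  \<open>basis_expansion\<close>.\<close>

definition basis_seq :: "'a::complex_inner set \<Rightarrow> (nat \<Rightarrow> 'a) \<Rightarrow> bool"
  where "basis_seq M e \<longleftrightarrow> orthonormal_seq e \<and> range e \<subseteq> M \<and>
    (\<forall>x\<in>M. (\<forall>n. cinner x (e n) = 0) \<longrightarrow> x = 0)"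

lemma orthonormal_seq_cinner:
  "orthonormal_seq e \<Longrightarrow> cinner (e i) (e j) = (if i = j \<and> e i \<noteq> 0 then 1 else 0)"
  by (auto simp: orthonormal_seq_def cinner_self)

lemma cinner_sum_orthonormal:
  assumes "orthonormal_seq e" "finite I"
  shows "cinner (\<Sum>i\<in>I. a i *\<^sub>C e i) (\<Sum>i\<in>I. b i *\<^sub>C e i)
    = (\<Sum>i\<in>I. if e i = 0 then 0 else a i * cnj (b i))"
proof -
  have "cinner (\<Sum>i\<in>I. a i *\<^sub>C e i) (b j *\<^sub>C e j) = (if e j = 0 then 0 else a j * cnj (b j))"
    if "j \<in> I" for j
  proof -
    have "cinner (\<Sum>i\<in>I. a i *\<^sub>C e i) (b j *\<^sub>C e j)
        = (\<Sum>i\<in>I. if i = j then (if e j = 0 then 0 else a j * cnj (b j)) else 0)"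
      unfolding cinner_sum_left
      by (intro sum.cong) (auto simp: cinner_simps orthonormal_seq_cinner[OF assms(1)])
    then show ?thesis
      using that assms(2) by simp
  qed
  then show ?thesis
    by (simp add: cinner_sum_right)
qed

lemma norm_sum_orthonormal_le:
  assumes "orthonormal_seq e" "finite I"
  shows "(norm (\<Sum>i\<in>I. a i *\<^sub>C e i))\<^sup>2 \<le> (\<Sum>i\<in>I. (norm (a i))\<^sup>2)"
proof -
  have "complex_of_real ((norm (\<Sum>i\<in>I. a i *\<^sub>C e i))\<^sup>2)
      = complex_of_real (\<Sum>i\<in>I. if e i = 0 then 0 else (norm (a i))\<^sup>2)"
    unfolding cinner_self[symmetric] cinner_sum_orthonormal[OF assms] of_real_sum
    by (intro sum.cong) (auto simp: complex_norm_square[symmetric])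
  then have "(norm (\<Sum>i\<in>I. a i *\<^sub>C e i))\<^sup>2 = (\<Sum>i\<in>I. if e i = 0 then 0 else (norm (a i))\<^sup>2)"
    by (simp only: of_real_eq_iff)
  also have "\<dots> \<le> (\<Sum>i\<in>I. (norm (a i))\<^sup>2)"
    by (intro sum_mono) auto
  finally show ?thesis .
qed

text \<open>Subtracting the partial Fourier sum \<open>s\<close> from \<open>x\<close> leaves a
  vector whose squared norm is \<open>(norm x)\<^sup>2\<close> minus the partial sum in question. As
  this is nonnegative, the partial sums stay bounded.\<close>

lemma bessel_summable:
  assumes "orthonormal_seq e"
  shows "summable (\<lambda>n. (norm (cinner x (e n)))\<^sup>2)"
proof (rule summableI_nonneg_bounded)
  fix n
  define a where "a i = cinner x (e i)" for i
  define s where "s = (\<Sum>i<n. a i *\<^sub>C e i)"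
  have xs: "cinner x s = complex_of_real (\<Sum>i<n. (norm (a i))\<^sup>2)"
    unfolding s_def cinner_sum_right of_real_sum complex_norm_square
    by (intro sum.cong) (simp_all add: a_def cinner_scaleC_right)
  have ss: "cinner s s = complex_of_real (\<Sum>i<n. (norm (a i))\<^sup>2)"
    unfolding s_def cinner_sum_orthonormal[OF assms finite_lessThan] of_real_sum complex_norm_square
    by (intro sum.cong) (auto simp: a_def)
  have "complex_of_real ((norm (x - s))\<^sup>2) = cinner x x - cinner x s - cnj (cinner x s) + cinner s s"
    unfolding cinner_self[symmetric] cinner_diff_left cinner_diff_right
    by (simp flip: cinner_commute)
  also have "\<dots> = complex_of_real ((norm x)\<^sup>2 - (\<Sum>i<n. (norm (a i))\<^sup>2))"
    unfolding xs ss cinner_self[of x] by simp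
  finally have "(norm (x - s))\<^sup>2 = (norm x)\<^sup>2 - (\<Sum>i<n. (norm (a i))\<^sup>2)"
    by (simp only: of_real_eq_iff)
  then show "(\<Sum>i<n. (norm (cinner x (e i)))\<^sup>2) \<le> (norm x)\<^sup>2"
    using zero_le_power2[of "norm (x - s)"] by (simp add: a_def)
qed simp

text \<open>By orthogonality the squared norm of a block of the vector series is at most the same
  block of the scalar series, so the Cauchy criterion passes from scalars to vectors.\<close>

lemma riesz_fischer:
  fixes e :: "nat \<Rightarrow> 'a::complex_hilbert"
  assumes "orthonormal_seq e" "summable (\<lambda>n. (norm (a n))\<^sup>2)"
  shows "summable (\<lambda>n. a n *\<^sub>C e n)"
proof (rule summable_Cauchy[THEN iffD2], intro allI impI)
  fix r :: real assume "0 < r"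
  then obtain N where N: "\<And>m n. m \<ge> N \<Longrightarrow> norm (\<Sum>i=m..<n. (norm (a i))\<^sup>2) < r\<^sup>2"
    using assms(2)[unfolded summable_Cauchy] by (metis zero_less_power)
  have "norm (\<Sum>i=m..<n. a i *\<^sub>C e i) < r" if "m \<ge> N" for m n
  proof -
    have "(norm (\<Sum>i=m..<n. a i *\<^sub>C e i))\<^sup>2 < r\<^sup>2"
      using norm_sum_orthonormal_le[OF assms(1), of "{m..<n}" a] N[OF that, of n] by (simp add: sum_nonneg)
    then show ?thesis
      using \<open>0 < r\<close> by (simp add: power_less_imp_less_base)
  qed
  then show "\<exists>N. \<forall>m\<ge>N. \<forall>n. norm (\<Sum>i=m..<n. a i *\<^sub>C e i) < r"
    by blast
qed

lemma cinner_orthonormal_series: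
  assumes "orthonormal_seq e" "(\<lambda>n. a n *\<^sub>C e n) sums x"
  shows "cinner x (e m) = (if e m = 0 then 0 else a m)"
proof -
  have "(\<lambda>n. cinner (a n *\<^sub>C e n) (e m)) sums cinner x (e m)"
    by (rule cinner_sums_left[OF assms(2)])
  moreover have "(\<lambda>n. cinner (a n *\<^sub>C e n) (e m)) = (\<lambda>n. if n = m then (if e m = 0 then 0 else a m) else 0)"
    by (rule ext) (auto simp: cinner_simps orthonormal_seq_cinner[OF assms(1)])
  ultimately show ?thesis
    using sums_single[of m "\<lambda>_. if e m = 0 then 0 else a m"] by (simp only:) (rule sums_unique2)
qed

lemma closed_csubspace_sums:
  assumes "closed_csubspace M" "\<And>n. f n \<in> M" "f sums x"
  shows "x \<in> M"
proof -
  have "(\<Sum>i<n. f i) \<in> M" for n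
    using assms by (intro complex_vector.subspace_sum) (auto simp: closed_csubspace_def)
  then show ?thesis
    using assms closed_sequentially[of M "\<lambda>n. \<Sum>i<n. f i"]
    by (auto simp: closed_csubspace_def sums_def)
qed

text \<open>Here \<open>x\<close> is any vector of the space, and \<open>p\<close> is its orthogonal
  projection onto \<open>M\<close>.\<close>

lemma orthonormal_expansion:
  fixes e :: "nat \<Rightarrow> 'a::complex_hilbert"
  assumes "closed_csubspace M" "basis_seq M e"
  obtains p where "p \<in> M" "(\<lambda>n. cinner x (e n) *\<^sub>C e n) sums p" "\<And>n. cinner (x - p) (e n) = 0"
proof -
  have e: "orthonormal_seq e" "\<And>n. e n \<in> M"
    using assms(2) by (auto simp: basis_seq_def)
  obtain p where p: "(\<lambda>n. cinner x (e n) *\<^sub>C e n) sums p"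
    using riesz_fischer[OF e(1) bessel_summable[OF e(1)]] by (auto simp: summable_def)
  have "p \<in> M"
    using assms(1) e(2) by (intro closed_csubspace_sums[OF _ _ p])
      (auto simp: closed_csubspace_def complex_vector.subspace_scale)
  moreover have "cinner (x - p) (e n) = 0" for n
    using cinner_orthonormal_series[OF e(1) p, of n] by (auto simp: cinner_simps)
  ultimately show thesis
    using \<open>p \<in> M\<close> p by (intro that)
qed

lemma basis_expansion:
  fixes e :: "nat \<Rightarrow> 'a::complex_hilbert"
  assumes "closed_csubspace M" "basis_seq M e" "x \<in> M"
  shows "(\<lambda>n. cinner x (e n) *\<^sub>C e n) sums x"
proof -
  obtain p where p: "p \<in> M" "(\<lambda>n. cinner x (e n) *\<^sub>C e n) sums p" "\<And>n. cinner (x - p) (e n) = 0"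
    by (rule orthonormal_expansion[OF assms(1,2), where x = x]) (rule that)
  have "x - p \<in> M"
    using assms(1,3) p(1) by (simp add: closed_csubspace_def complex_vector.subspace_diff)
  then have "x = p"
    using assms(2) p(3) by (auto simp: basis_seq_def)
  then show ?thesis
    using p(2) by simp
qed

section \<open>Existence of countable orthonormal bases\<close>

lemma exists_orthonormal_set:
  fixes M :: "'a::complex_inner set"
  assumes "csubspace M"
  obtains E where "E \<subseteq> M" "\<And>x. x \<in> E \<Longrightarrow> norm x = 1"
    "\<And>x y. x \<in> E \<Longrightarrow> y \<in> E \<Longrightarrow> x \<noteq> y \<Longrightarrow> cinner x y = 0"
    "\<And>x. x \<in> M \<Longrightarrow> \<forall>y\<in>E. cinner x y = 0 \<Longrightarrow> x = 0"
proof -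
  define A where "A = {E. E \<subseteq> M \<and> (\<forall>x\<in>E. norm x = 1) \<and> (\<forall>x\<in>E. \<forall>y\<in>E. x \<noteq> y \<longrightarrow> cinner x y = 0)}"
  have "\<Union>C \<in> A" if "subset.chain A C" for C
  proof -
    have CA: "C \<subseteq> A" and tot: "\<And>X Y. X \<in> C \<Longrightarrow> Y \<in> C \<Longrightarrow> X \<subseteq> Y \<or> Y \<subseteq> X"
      using that by (auto simp: subset_chain_def)
    have "cinner x y = 0" if "x \<in> X" "X \<in> C" "y \<in> Y" "Y \<in> C" "x \<noteq> y" for x y X Y
    proof -
      have "\<forall>x\<in>Z. \<forall>y\<in>Z. x \<noteq> y \<longrightarrow> cinner x y = 0" if "Z \<in> C" for Z
        using CA that by (auto simp: A_def)
      then show ?thesis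
        using tot[OF that(2,4)] that by blast
    qed
    moreover have "\<Union>C \<subseteq> M" "\<forall>x\<in>\<Union>C. norm x = 1"
      using CA by (auto simp: A_def)
    ultimately show ?thesis
      unfolding A_def by simp
  qed
  then obtain E where E: "E \<in> A" and max: "\<And>X. X \<in> A \<Longrightarrow> E \<subseteq> X \<Longrightarrow> X = E"
    using subset_Zorn'[of A] by metis
  \<comment> \<open>Otherwise the normalised \<open>x\<close> could be added to \<open>E\<close>,
    against maximality.\<close>
  have "x = 0" if x: "x \<in> M" "\<And>y. y \<in> E \<Longrightarrow> cinner x y = 0" for x
  proof (rule ccontr)
    assume "x \<noteq> 0"
    define u where "u = complex_of_real (1 / norm x) *\<^sub>C x"
    have u: "norm u = 1" "u \<in> M" "\<And>y. y \<in> E \<Longrightarrow> cinner u y = 0"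
      using \<open>x \<noteq> 0\<close> x assms by (auto simp: u_def norm_scaleC norm_divide cinner_simps complex_vector.subspace_scale)
    then have "\<And>y. y \<in> E \<Longrightarrow> cinner y u = 0"
      by (metis cinner_commute complex_cnj_zero)
    then have "insert u E \<in> A"
      using E u by (auto simp: A_def)
    then have "u \<in> E"
      using max by blast
    then show False
      using u by (metis cinner_self_eq_0 norm_zero zero_neq_one)
  qed
  then show thesis
    using E by (intro that[of E]) (simp_all add: A_def subset_iff)
qed

text \<open>Distinct members have squared distance 2, so the balls of radius 1/2 around them are
  disjoint, and a second countable space contains only countably many disjoint nonempty open
  sets.\<close>

lemma countable_orthonormal_set:
  fixes E :: "'a::{complex_inner, second_countable_topology} set"
  assumes "\<And>x. x \<in> E \<Longrightarrow> norm x = 1" "\<And>x y. x \<in> E \<Longrightarrow> y \<in> E \<Longrightarrow> x \<noteq> y \<Longrightarrow> cinner x y = 0"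
  shows "countable E"
proof -
  have far: "dist x y \<ge> 1" if "x \<in> E" "y \<in> E" "x \<noteq> y" for x y
  proof -
    have "(dist x y)\<^sup>2 = 2"
      using assms that
      by (simp add: dist_norm power2_norm_eq_inner inner_diff inner_commute[of y x])
        (simp add: inner_eq_Re_cinner cinner_self)
    then show ?thesis
      by (metis le_numeral_extra(4) one_le_numeral power2_le_imp_le one_power2 zero_le_dist)
  qed
  define f where "f x = ball x (1 / 2 :: real)" for x :: 'a
  have dis: "f x \<inter> f y = {}" if "x \<in> E" "y \<in> E" "x \<noteq> y" for x y
  proof (rule ccontr)
    assume "f x \<inter> f y \<noteq> {}"
    then obtain z where "dist x z < 1 / 2" "dist y z < 1 / 2"
      by (auto simp: f_def)
    then show False
      using far[OF that] dist_triangle2[of x y z] by linarith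
  qed
  have inj: "inj_on f E"
  proof (rule inj_onI, rule ccontr)
    fix x y assume "x \<in> E" "y \<in> E" "f x = f y" "x \<noteq> y"
    then have "f x = {}" using dis by blast
    then show False by (auto simp: f_def)
  qed
  have "pairwise disjnt (f ` E)"
    using dis by (auto simp: pairwise_def disjnt_def)
  then have "countable (f ` E)"
    by (intro countable_disjoint_open_subsets) (auto simp: f_def)
  then show ?thesis
    using inj by (rule countable_image_inj_on)
qed

lemma exists_basis_seq:
  fixes M :: "'a::{complex_inner, second_countable_topology} set"
  assumes "csubspace M"
  shows "\<exists>e. basis_seq M e \<and> (hdim M = \<infinity> \<longrightarrow> (\<forall>n. e n \<noteq> 0))"
proof -
  obtain E where E: "E \<subseteq> M" "\<And>x. x \<in> E \<Longrightarrow> norm x = 1"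
      "\<And>x y. x \<in> E \<Longrightarrow> y \<in> E \<Longrightarrow> x \<noteq> y \<Longrightarrow> cinner x y = 0"
      "\<And>x. x \<in> M \<Longrightarrow> \<forall>y\<in>E. cinner x y = 0 \<Longrightarrow> x = 0"
    by (rule exists_orthonormal_set[OF assms]) (rule that)
  have count: "countable E"
    using E(2,3) by (rule countable_orthonormal_set)
  show ?thesis
  proof (cases "finite E")
    case True
    have "M \<subseteq> cspan E"
    proof
      fix x assume x: "x \<in> M"
      define p where "p = (\<Sum>y\<in>E. cinner x y *\<^sub>C y)"
      have p: "p \<in> cspan E"
        unfolding p_def by (intro complex_vector.span_sum complex_vector.span_scale complex_vector.span_base)
      then have "p \<in> M"
        using complex_vector.span_minimal[OF E(1) assms] by blast
      moreover have "cinner p z = cinner x z" if "z \<in> E" for z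
      proof -
        have "cinner p z = (\<Sum>y\<in>E. if y = z then cinner x z else 0)"
          unfolding p_def cinner_sum_left
          using E(2,3) that by (intro sum.cong) (auto simp: cinner_simps cinner_self)
        then show ?thesis
          using True that by simp
      qed
      ultimately have "x - p = 0"
        using x assms by (intro E(4)) (auto simp: cinner_simps complex_vector.subspace_diff)
      then show "x \<in> cspan E"
        using p by simp
    qed
    then have "hdim M \<noteq> \<infinity>"
      using True unfolding hdim_def by auto
    moreover obtain f :: "'a \<Rightarrow> nat" where f: "inj_on f E"
      using count by (auto simp: countable_def)
    \<comment> \<open>Indices that number no element of \<open>E\<close> are padded with zero
      entries, which \<open>orthonormal_seq\<close> allows; the claim about nonzero entries is
      vacuous since \<open>hdim M\<close> is finite here.\<close>
    define e where "e n = (if n \<in> f ` E then the_inv_into E f n else 0)" for n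
    have e: "e (f y) = y" if "y \<in> E" for y
      using that f by (simp add: e_def the_inv_into_f_f)
    have e': "e n = 0 \<or> (e n \<in> E \<and> f (e n) = n)" for n
      using e by (auto simp: e_def the_inv_into_f_f[OF f])
    have "basis_seq M e"
      unfolding basis_seq_def orthonormal_seq_def
    proof (intro conjI allI impI ballI)
      show "e n = 0 \<or> norm (e n) = 1" for n
        using e' E(2) by blast
      show "cinner (e m) (e n) = 0" if "m \<noteq> n" for m n
      proof (cases "e m = 0 \<or> e n = 0")
        case False
        then have "e m \<noteq> e n"
          using e'[of m] e'[of n] that by metis
        then show ?thesis
          using False e'[of m] e'[of n] E(3) by blast
      qed auto
      show "range e \<subseteq> M"
        using e' E(1) assms by (auto simp: image_subset_iff) (metis complex_vector.subspace_0 subsetD)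
      show "x = 0" if "x \<in> M" "\<forall>n. cinner x (e n) = 0" for x
        using that e E(4) by metis
    qed
    ultimately show ?thesis
      by (intro exI[of _ e]) auto
  next
    case False
    then have bij: "bij_betw (from_nat_into E) UNIV E"
      by (rule bij_betw_from_nat_into[OF count])
    define e where "e = from_nat_into E"
    have e: "e n \<in> E" "m \<noteq> n \<Longrightarrow> e m \<noteq> e n" "E = range e" for m n
      using bij by (auto simp: e_def bij_betw_def inj_def)
    have nz: "e n \<noteq> 0" for n
      using E(2)[OF e(1)[of n]] by auto
    have "basis_seq M e"
      unfolding basis_seq_def orthonormal_seq_def
    proof (intro conjI allI impI ballI)
      show "e n = 0 \<or> norm (e n) = 1" for n
        using e(1) E(2) by blast
      show "cinner (e m) (e n) = 0" if "m \<noteq> n" for m n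
        using e(1) e(2)[OF that] E(3) by blast
      show "range e \<subseteq> M"
        using e(3) E(1) by blast
      show "x = 0" if "x \<in> M" "\<forall>n. cinner x (e n) = 0" for x
        using that e(3) E(4) by (metis imageE)
    qed
    then show ?thesis
      using nz by (intro exI[of _ e]) simp
  qed
qed

section \<open>Orthogonal projections and unitary identification of subspaces\<close>

lemma orthogonal_decomposition:
  fixes M :: "'a::{complex_hilbert, second_countable_topology} set"
  assumes "closed_csubspace M" "csubspace K" "M \<subseteq> K" "x \<in> K"
  obtains p q where "x = p + q" "p \<in> M" "q \<in> K \<ominus> M"
proof -
  have M: "csubspace M"
    using assms(1) by (simp add: closed_csubspace_def)
  obtain e where e: "basis_seq M e"
    using exists_basis_seq[OF M] by blast
  obtain p where p: "p \<in> M" "\<And>n. cinner (x - p) (e n) = 0"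
    by (rule orthonormal_expansion[OF assms(1) e, where x = x]) (rule that)
  \<comment> \<open>Orthogonality to the basis extends to all of \<open>M\<close> by expanding
    \<open>m\<close>.\<close>
  have "cinner (x - p) m = 0" if "m \<in> M" for m
  proof -
    have "(\<lambda>n. cinner (x - p) (cinner m (e n) *\<^sub>C e n)) sums cinner (x - p) m"
      by (rule cinner_sums_right[OF basis_expansion[OF assms(1) e that]])
    then show ?thesis
      by (simp add: cinner_scaleC_right p(2) sums_iff)
  qed
  moreover have "x - p \<in> K"
    using assms p by (auto intro: complex_vector.subspace_diff)
  ultimately show thesis
    using p(1) by (intro that[of p "x - p"]) (auto simp: orth_diff_def)
qed

text \<open>A basis of \<open>M\<close> is sent to a basis of \<open>N\<close>. The map is defined
  on the whole space through the coefficients and kills the orthogonal complement of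
  \<open>M\<close>, so the isometry property is stated on \<open>M\<close> only.\<close>

lemma exists_unitary:
  fixes M N :: "'a::{complex_hilbert, second_countable_topology} set"
  assumes M: "closed_csubspace M" "hdim M = \<infinity>" and N: "closed_csubspace N" "hdim N = \<infinity>"
  obtains \<phi> where "clinear \<phi>" "\<And>x. \<phi> x \<in> N"
    "\<And>x y. x \<in> M \<Longrightarrow> y \<in> M \<Longrightarrow> cinner (\<phi> x) (\<phi> y) = cinner x y" "\<phi> ` M = N"
proof -
  obtain e k where e: "basis_seq M e" "\<And>n. e n \<noteq> 0" and k: "basis_seq N k" "\<And>n. k n \<noteq> 0"
    using exists_basis_seq[of M] exists_basis_seq[of N] M N by (auto simp: closed_csubspace_def)
  have on: "orthonormal_seq e" "orthonormal_seq k"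
    using e(1) k(1) by (auto simp: basis_seq_def)
  define \<phi> where "\<phi> x = (\<Sum>n. cinner x (e n) *\<^sub>C k n)" for x
  have \<phi>: "(\<lambda>n. cinner x (e n) *\<^sub>C k n) sums \<phi> x" for x
    unfolding \<phi>_def using riesz_fischer[OF on(2) bessel_summable[OF on(1)]] by (rule summable_sums)
  have inN: "\<phi> x \<in> N" for x
    using N(1) k(1) by (intro closed_csubspace_sums[OF _ _ \<phi>])
      (auto simp: closed_csubspace_def basis_seq_def intro!: complex_vector.subspace_scale)
  have lin: "clinear \<phi>"
  proof (rule clinearI)
    show "\<phi> (x + y) = \<phi> x + \<phi> y" for x y
      using sums_add[OF \<phi>[of x] \<phi>[of y]] \<phi>[of "x + y"]
      by (simp add: cinner_simps scaleC_add_left sums_unique2)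
    show "\<phi> (c *\<^sub>C x) = c *\<^sub>C \<phi> x" for c x
      using scaleC_sums_right[OF \<phi>[of x], of c] \<phi>[of "c *\<^sub>C x"]
      by (simp add: cinner_simps scaleC_scaleC sums_unique2)
  qed
  \<comment> \<open>Both sides are limits of the same numbers: inner products of finite sums depend
    only on the coefficients, because neither sequence has a zero entry.\<close>
  have iso: "cinner (\<phi> x) (\<phi> y) = cinner x y" if "x \<in> M" "y \<in> M" for x y
  proof (rule LIMSEQ_unique)
    show "(\<lambda>n. cinner (\<Sum>i<n. cinner x (e i) *\<^sub>C k i) (\<Sum>i<n. cinner y (e i) *\<^sub>C k i))
        \<longlonglongrightarrow> cinner (\<phi> x) (\<phi> y)"
      using \<phi>[of x] \<phi>[of y] unfolding sums_def by (rule tendsto_cinner)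
    have "(\<lambda>n. cinner (\<Sum>i<n. cinner x (e i) *\<^sub>C e i) (\<Sum>i<n. cinner y (e i) *\<^sub>C e i)) \<longlonglongrightarrow> cinner x y"
      using basis_expansion[OF M(1) e(1) that(1)] basis_expansion[OF M(1) e(1) that(2)]
      unfolding sums_def by (rule tendsto_cinner)
    then show "(\<lambda>n. cinner (\<Sum>i<n. cinner x (e i) *\<^sub>C k i) (\<Sum>i<n. cinner y (e i) *\<^sub>C k i)) \<longlonglongrightarrow> cinner x y"
      by (simp add: cinner_sum_orthonormal on e(2) k(2))
  qed
  have "y \<in> \<phi> ` M" if y: "y \<in> N" for y
  proof -
    obtain x where x: "(\<lambda>n. cinner y (k n) *\<^sub>C e n) sums x"
      using riesz_fischer[OF on(1) bessel_summable[OF on(2)]] by (auto simp: summable_def)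
    have "x \<in> M"
      using M(1) e(1) by (intro closed_csubspace_sums[OF _ _ x])
        (auto simp: closed_csubspace_def basis_seq_def intro!: complex_vector.subspace_scale)
    moreover have "\<phi> x = y"
      using basis_expansion[OF N(1) k(1) y] \<phi>[of x]
      by (simp add: cinner_orthonormal_series[OF on(1) x] e(2) sums_unique2)
    ultimately show ?thesis by blast
  qed
  then show thesis
    using that[OF lin inN iso] inN by blast
qed

section \<open>Symmetric operators with trivially intersecting ranges\<close>

text \<open>The lowest nonvanishing term of the series would dominate all others as \<open>n\<close> grows.\<close>

lemma lacunary_series_eq_0:
  fixes t :: "nat \<Rightarrow> complex"
  assumes bound: "\<And>k. norm (t k) \<le> C"
    and sums: "\<And>n. n \<ge> 1 \<Longrightarrow> (\<lambda>k. t k * (1/2) ^ (n * k)) sums s n"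
    and decay: "\<And>m. (\<lambda>n. s n * 2 ^ (n * m)) \<longlonglongrightarrow> 0"
  shows "t m = 0"
proof (induction m rule: less_induct)
  case (less m)
  have est: "norm (t m - s n * 2 ^ (n * m)) \<le> 2 * C * (1/2) ^ n" if n: "n \<ge> 1" for n
  proof -
    \<comment> \<open>The terms below \<open>m\<close> vanish by the induction hypothesis;
      multiplying the rest by \<open>2 ^ (n * m)\<close> makes \<open>t m\<close> the constant
      term.\<close>
    have "(\<Sum>i<m. t i * (1/2) ^ (n * i)) = 0"
      by (simp add: less)
    then have "(\<lambda>k. t (k + m) * (1/2) ^ (n * (k + m))) sums s n"
      using sums_split_initial_segment[OF sums[OF n], of m] by simp
    from sums_mult[OF this, of "2 ^ (n * m)"]
    have "(\<lambda>k. t (k + m) * (1/2) ^ (n * k)) sums (s n * 2 ^ (n * m))"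
      by (simp add: distrib_left power_add field_simps)
    from sums_split_initial_segment[OF this, of 1]
    have tail: "(\<lambda>k. t (Suc k + m) * (1/2) ^ (n * Suc k)) sums (s n * 2 ^ (n * m) - t m)"
      by simp
    \<comment> \<open>As \<open>n \<ge> 1\<close>, one geometric series in \<open>k\<close>
      dominates all tails; the factor \<open>(1/2) ^ n\<close> split off makes the tails vanish as
      \<open>n\<close> grows.\<close>
    have le: "norm (t (Suc k + m) * (1/2) ^ (n * Suc k)) \<le> C * (1/2) ^ n * (1/2) ^ k" for k
    proof -
      have "(1/2) ^ (n * k) \<le> (1/2 :: real) ^ k"
        using n by (intro power_decreasing) auto
      then have "norm (t (Suc k + m)) * ((1/2) ^ n * (1/2) ^ (n * k)) \<le> C * ((1/2) ^ n * (1/2) ^ k)"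
        using bound by (intro mult_mono) (auto intro: order_trans[OF norm_ge_zero])
      then show ?thesis
        by (simp add: norm_mult norm_power norm_divide power_add mult.assoc)
    qed
    have geo: "(\<lambda>k. C * (1/2) ^ n * (1/2) ^ k) sums (C * (1/2) ^ n * 2)"
      using sums_mult[OF geometric_sums[of "1/2 :: real"], of "C * (1/2) ^ n"] by simp
    have "norm (s n * 2 ^ (n * m) - t m) \<le> C * (1/2) ^ n * 2"
      using norm_suminf_le[OF le sums_summable[OF geo]] tail geo by (simp only: sums_iff)
    then show ?thesis
      by (simp add: norm_minus_commute mult_ac)
  qed
  have "(\<lambda>n. t m - s n * 2 ^ (n * m)) \<longlonglongrightarrow> t m - 0"
    by (intro tendsto_diff tendsto_const decay)
  moreover have "(\<lambda>n. t m - s n * 2 ^ (n * m)) \<longlonglongrightarrow> 0"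
  proof (rule Lim_null_comparison)
    show "\<forall>\<^sub>F n in sequentially. norm (t m - s n * 2 ^ (n * m)) \<le> 2 * C * (1/2) ^ n"
      using est by (auto simp: eventually_sequentially)
    have "(\<lambda>n. 2 * C * (1/2) ^ n) \<longlonglongrightarrow> 2 * C * 0"
      by (intro tendsto_mult tendsto_const LIMSEQ_power_zero) simp
    then show "(\<lambda>n. 2 * C * (1/2) ^ n) \<longlonglongrightarrow> 0"
      by simp
  qed
  ultimately show ?case
    using LIMSEQ_unique by fastforce
qed

section \<open>Frame operators with geometric weights\<close>

definition weighted_frame_op :: "(nat \<Rightarrow> 'a::complex_hilbert) \<Rightarrow> 'a \<Rightarrow> 'a"
  where "weighted_frame_op c x = (\<Sum>n. ((1/2) ^ n * cinner x (c n)) *\<^sub>C c n)"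

context
  fixes c :: "nat \<Rightarrow> 'a::complex_hilbert" and C :: real
  assumes bound: "\<And>n. norm (c n) \<le> C"
begin

text \<open>The weights \<open>(1/2) ^ n\<close> make the series converge absolutely for every
  bounded family \<open>c\<close>, orthogonal or not.\<close>

lemma weighted_frame_op_sums:
  "(\<lambda>n. ((1/2) ^ n * cinner x (c n)) *\<^sub>C c n) sums weighted_frame_op c x"
  unfolding weighted_frame_op_def
proof (rule summable_sums, rule summable_comparison_test')
  have "0 \<le> C"
    using bound[of 0] norm_ge_zero order_trans by blast
  fix n :: nat
  have "norm (((1/2) ^ n * cinner x (c n)) *\<^sub>C c n) = (1/2) ^ n * (norm (cinner x (c n)) * norm (c n))"
    by (simp add: norm_scaleC norm_mult norm_power norm_divide)
  also have "\<dots> \<le> (1/2) ^ n * ((norm x * C) * C)"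
    using \<open>0 \<le> C\<close> bound[of n] order_trans[OF cinner_norm_le mult_left_mono[OF bound norm_ge_zero]]
    by (intro mult_left_mono mult_mono) auto
  finally show "norm (((1/2) ^ n * cinner x (c n)) *\<^sub>C c n) \<le> (1/2) ^ n * ((norm x * C) * C)" .
  show "summable (\<lambda>n. (1/2) ^ n * ((norm x * C) * C))"
    by (intro summable_mult2 summable_geometric) simp
qed

lemma clinear_weighted_frame_op: "clinear (weighted_frame_op c)"
proof (rule clinearI)
  show "weighted_frame_op c (x + y) = weighted_frame_op c x + weighted_frame_op c y" for x y
    using sums_add[OF weighted_frame_op_sums[of x] weighted_frame_op_sums[of y]]
      weighted_frame_op_sums[of "x + y"]
    by (simp add: cinner_simps distrib_left scaleC_add_left sums_unique2)
  show "weighted_frame_op c (a *\<^sub>C x) = a *\<^sub>C weighted_frame_op c x" for a x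
    using scaleC_sums_right[OF weighted_frame_op_sums[of x], of a] weighted_frame_op_sums[of "a *\<^sub>C x"]
    by (simp add: cinner_simps scaleC_scaleC sums_unique2 mult.left_commute)
qed

lemma cinner_weighted_frame_op:
  "(\<lambda>n. (1/2) ^ n * cinner x (c n) * cinner (c n) y) sums cinner (weighted_frame_op c x) y"
  using cinner_sums_left[OF weighted_frame_op_sums[of x], of y] by (simp add: cinner_simps)

lemma weighted_frame_op_symmetric:
  "cinner (weighted_frame_op c x) y = cinner x (weighted_frame_op c y)"
proof -
  have "(\<lambda>n. cinner x (((1/2) ^ n * cinner y (c n)) *\<^sub>C c n)) sums cinner x (weighted_frame_op c y)"
    by (rule cinner_sums_right[OF weighted_frame_op_sums])
  moreover have "(\<lambda>n. cinner x (((1/2) ^ n * cinner y (c n)) *\<^sub>C c n))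
      = (\<lambda>n. (1/2) ^ n * cinner x (c n) * cinner (c n) y)"
    by (rule ext) (simp add: cinner_simps flip: cinner_commute)
  ultimately show ?thesis
    using cinner_weighted_frame_op[of x y] by (simp add: sums_unique2)
qed

text \<open>Pairing the series with \<open>x\<close> gives the nonnegative terms
  \<open>(1/2) ^ n * (norm (cinner x (c n)))\<^sup>2\<close> with sum zero, so every term
  vanishes.\<close>

lemma weighted_frame_op_eq_0:
  assumes "weighted_frame_op c x = 0"
  shows "cinner x (c n) = 0"
proof -
  have "(\<lambda>n. (1/2) ^ n * cinner x (c n) * cinner (c n) x) sums 0"
    using cinner_weighted_frame_op[of x x] assms by simp
  moreover have "(1/2) ^ n * cinner x (c n) * cinner (c n) x
      = complex_of_real ((1/2) ^ n * (norm (cinner x (c n)))\<^sup>2)" for n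
    by (simp add: cinner_commute[of "c n" x] complex_norm_square[symmetric] mult.assoc)
  ultimately have "(\<lambda>n. complex_of_real ((1/2) ^ n * (norm (cinner x (c n)))\<^sup>2)) sums complex_of_real 0"
    by (simp only: of_real_0)
  then have "(\<lambda>n. (1/2) ^ n * (norm (cinner x (c n)))\<^sup>2) sums 0"
    by (simp only: sums_of_real_iff)
  then have "(1/2) ^ n * (norm (cinner x (c n)))\<^sup>2 = 0"
    using suminf_eq_zero_iff[of "\<lambda>n. (1/2) ^ n * (norm (cinner x (c n)))\<^sup>2"] by (simp add: sums_iff)
  then show ?thesis by simp
qed

end

text \<open>
  In the coordinates of an orthonormal basis of \<open>M\<close>, the range of \<open>P\<close> consists of sequences decaying
  faster than exponentially, whereas every nonzero vector in the range of \<open>Q\<close> is an infinite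
  combination of distinct geometric progressions and therefore decays at most exponentially.
\<close>

lemma exists_symmetric_disjoint_ranges:
  fixes M :: "'a::{complex_hilbert, second_countable_topology} set"
  assumes M: "closed_csubspace M" "hdim M = \<infinity>"
  obtains P Q :: "'a \<Rightarrow> 'a" where "clinear P" "clinear Q" "\<And>x. P x \<in> M" "\<And>x. Q x \<in> M"
    "\<And>x y. cinner (P x) y = cinner x (P y)" "\<And>x y. cinner (Q x) y = cinner x (Q y)"
    "\<And>x y. x \<in> M \<Longrightarrow> y \<in> M \<Longrightarrow> P x = Q y \<Longrightarrow> x = 0 \<and> y = 0"
proof -
  obtain e where e: "basis_seq M e" "\<And>n. e n \<noteq> 0"
    using exists_basis_seq[of M] M by (auto simp: closed_csubspace_def)
  have on: "orthonormal_seq e" and eM: "\<And>n. e n \<in> M"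
    and tot: "\<And>x. x \<in> M \<Longrightarrow> (\<And>n. cinner x (e n) = 0) \<Longrightarrow> x = 0"
    using e(1) by (auto simp: basis_seq_def)
  have ee: "cinner (e i) (e j) = (if i = j then 1 else 0)" for i j
    using orthonormal_seq_cinner[OF on] e(2) by simp
  have norm_e [simp]: "norm (e n) = 1" for n
    using on e(2) by (auto simp: orthonormal_seq_def)
  have scaleM: "a *\<^sub>C x \<in> M" if "x \<in> M" for a x
    using M(1) that by (simp add: closed_csubspace_def complex_vector.subspace_scale)
  \<comment> \<open>With this choice \<open>P\<close> is diagonal in the basis \<open>e\<close>,
    with eigenvalues \<open>(1/2) ^ n / (fact n)\<^sup>2\<close>.\<close>
  define c where "c n = (1 / fact n) *\<^sub>C e n" for n
  \<comment> \<open>The coordinates of \<open>b j\<close> form the geometric progression with ratio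
    \<open>(1/2) ^ Suc j\<close>; the successor keeps the ratio below 1 even for
    \<open>j = 0\<close>.\<close>
  define b where "b j = (\<Sum>n. (1/2) ^ (Suc j * n) *\<^sub>C e n)" for j
  have c_bound: "norm (c n) \<le> 1" for n
    by (simp add: c_def norm_scaleC norm_divide)
  have pow_le: "norm ((1/2) ^ (Suc j * n) *\<^sub>C e n) \<le> (1/2) ^ n" for j n
    by (simp add: norm_scaleC norm_power norm_divide power_decreasing)
  have "summable (\<lambda>n. (1/2 :: real) ^ n)"
    by (intro summable_geometric) simp
  note b_summable = summable_comparison_test'[OF this pow_le]
  have b_sums: "(\<lambda>n. (1/2) ^ (Suc j * n) *\<^sub>C e n) sums b j" for j
    unfolding b_def by (intro summable_sums b_summable)
  have b_bound: "norm (b j) \<le> 2" for j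
    unfolding b_def
    by (rule order_trans[OF norm_suminf_le[OF pow_le \<open>summable (\<lambda>n. (1/2 :: real) ^ n)\<close>]])
      (simp add: suminf_geometric)
  have b_e: "cinner (b j) (e n) = (1/2) ^ (Suc j * n)" for j n
    using cinner_orthonormal_series[OF on b_sums] e(2) by simp
  have bM: "b j \<in> M" for j
    by (rule closed_csubspace_sums[OF M(1) scaleM[OF eM] b_sums])
  have cM: "c j \<in> M" for j
    using eM scaleM by (simp add: c_def)
  define P where "P = weighted_frame_op c"
  define Q where "Q = weighted_frame_op b"
  have PM: "P x \<in> M" for x
    unfolding P_def by (rule closed_csubspace_sums[OF M(1) scaleM[OF cM] weighted_frame_op_sums[OF c_bound]])
  have QM: "Q x \<in> M" for x
    unfolding Q_def by (rule closed_csubspace_sums[OF M(1) scaleM[OF bM] weighted_frame_op_sums[OF b_bound]])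
  have inj_P: "x = 0" if "x \<in> M" "P x = 0" for x
    using weighted_frame_op_eq_0[of c, OF c_bound that(2)[unfolded P_def]] that(1)
    by (intro tot) (auto simp: c_def cinner_simps)
  \<comment> \<open>A vector killed by \<open>Q\<close> is orthogonal to every \<open>b j\<close>.
    These conditions say that the series with coefficients \<open>cinner x (e k)\<close> has sum
    zero for every \<open>n \<ge> 1\<close>, so the lacunary lemma applies with zero sums.\<close>
  have inj_Q: "x = 0" if "x \<in> M" "Q x = 0" for x
  proof (rule tot[OF that(1)])
    fix m
    have "(\<lambda>k. cinner x (e k) * (1/2) ^ (n * k)) sums 0" if "n \<ge> 1" for n
    proof -
      obtain j where "n = Suc j"
        using \<open>n \<ge> 1\<close> by (cases n) auto
      then show ?thesis
        using cinner_sums_right[OF b_sums[of j], of x]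
          weighted_frame_op_eq_0[of b, OF b_bound \<open>Q x = 0\<close>[unfolded Q_def], of j]
        by (simp add: cinner_simps mult.commute)
    qed
    moreover have "norm (cinner x (e k)) \<le> norm x" for k
      using cinner_norm_le[of x "e k"] by simp
    ultimately show "cinner x (e m) = 0"
      by (intro lacunary_series_eq_0[of "\<lambda>k. cinner x (e k)" _ "\<lambda>_. 0"]) auto
  qed
  have disj: "x = 0 \<and> y = 0" if xy: "x \<in> M" "y \<in> M" "P x = Q y" for x y
  proof -
    \<comment> \<open>\<open>t j\<close> is the coefficient of \<open>b j\<close> in
      \<open>Q y\<close>. The coordinate of \<open>Q y\<close> at \<open>e n\<close> is the sum of
      the \<open>t k * (1/2) ^ (Suc k * n)\<close>, and the factor \<open>2 ^ n\<close> in
      \<open>s n\<close> turns \<open>Suc k\<close> into \<open>k\<close>.\<close>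
    define t where "t j = (1/2) ^ j * cinner y (b j)" for j
    define s where "s n = cinner (Q y) (e n) * 2 ^ n" for n
    have "t m = 0" for m
    proof (rule lacunary_series_eq_0)
      show "norm (t k) \<le> norm y * 2" for k
      proof -
        have "norm (t k) \<le> 1 * norm (cinner y (b k))"
          unfolding t_def norm_mult by (intro mult_right_mono) (auto simp: norm_power norm_divide power_le_one)
        also have "\<dots> \<le> norm y * 2"
          using order_trans[OF cinner_norm_le mult_left_mono[OF b_bound norm_ge_zero]] by simp
        finally show ?thesis .
      qed
      show "(\<lambda>k. t k * (1/2) ^ (n * k)) sums s n" if "n \<ge> 1" for n
      proof -
        have "(\<lambda>k. t k * (1/2) ^ (Suc k * n)) sums cinner (Q y) (e n)"
          using cinner_weighted_frame_op[of b, OF b_bound, of y "e n"] by (simp add: Q_def t_def b_e)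
        from sums_mult[OF this, of "2 ^ n"] show ?thesis
          by (simp add: s_def power_add field_simps)
      qed
      \<comment> \<open>Since \<open>Q y = P x\<close>, the eigenvalues of \<open>P\<close> enter,
        and their factorials outweigh \<open>(2 ^ m) ^ n\<close>. One of the two factorials is given
        up, which leaves the terms of an exponential series.\<close>
      show "(\<lambda>n. s n * 2 ^ (n * m)) \<longlonglongrightarrow> 0" for m
      proof (rule Lim_null_comparison)
        have Pe: "cinner (P x) (e n) = (1/2) ^ n * (1 / fact n) ^ 2 * cinner x (e n)" for n
        proof -
          have "cinner (P x) (e n) = (\<Sum>k. (1/2) ^ k * cinner x (c k) * cinner (c k) (e n))"
            using cinner_weighted_frame_op[of c, OF c_bound, of x "e n"] by (simp add: P_def sums_iff)
          also have "\<dots> = (\<Sum>k. if k = n then (1/2) ^ n * (1 / fact n) ^ 2 * cinner x (e n) else 0)"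
            by (intro suminf_cong) (auto simp: c_def cinner_simps ee power2_eq_square)
          also have "\<dots> = (1/2) ^ n * (1 / fact n) ^ 2 * cinner x (e n)"
            by (rule sums_unique[OF sums_single, symmetric])
          finally show ?thesis .
        qed
        have "norm (s n * 2 ^ (n * m)) \<le> norm x * ((2 ^ m) ^ n / fact n)" for n
        proof -
          have "s n * 2 ^ (n * m) = (1 / fact n) ^ 2 * cinner x (e n) * (2 ^ m) ^ n"
            unfolding s_def xy(3)[symmetric] Pe
            by (simp add: power_mult[symmetric] mult.commute[of n m] power_one_over field_simps)
          then have "norm (s n * 2 ^ (n * m)) = norm ((1 / fact n) ^ 2 * cinner x (e n) * (2 ^ m) ^ n)"
            by (rule arg_cong)
          also have "\<dots> = norm (cinner x (e n)) * ((2 ^ m) ^ n / (fact n) ^ 2)"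
            by (simp add: norm_mult norm_power norm_divide power_one_over field_simps)
          also have "\<dots> \<le> norm x * ((2 ^ m) ^ n / fact n)"
            using cinner_norm_le[of x "e n"]
            by (intro mult_mono divide_left_mono) (auto simp: self_le_power)
          finally show ?thesis .
        qed
        then show "\<forall>\<^sub>F n in sequentially. norm (s n * 2 ^ (n * m)) \<le> norm x * ((2 ^ m) ^ n / fact n)"
          by simp
        have "(\<lambda>n. (2 ^ m :: real) ^ n / fact n) \<longlonglongrightarrow> 0"
          using summable_LIMSEQ_zero[OF summable_exp[of "2 ^ m :: real"]] by (simp add: field_simps)
        from tendsto_mult[OF tendsto_const[of "norm x"] this]
        show "(\<lambda>n. norm x * ((2 ^ m) ^ n / fact n)) \<longlonglongrightarrow> 0"
          by simp
      qed
    qed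
    then have "Q y = 0"
      using weighted_frame_op_sums[of b, OF b_bound, of y] by (simp add: Q_def t_def sums_iff)
    then show ?thesis
      using xy inj_P inj_Q by auto
  qed
  show thesis
    by (rule that[OF clinear_weighted_frame_op[of c, OF c_bound, folded P_def]
        clinear_weighted_frame_op[of b, OF b_bound, folded Q_def] PM QM
        weighted_frame_op_symmetric[of c, OF c_bound, folded P_def]
        weighted_frame_op_symmetric[of b, OF b_bound, folded Q_def] disj])
qed

section \<open>Selfadjoint extensions\<close>

lemma operator_inD:
  assumes "operator_in K T"
  shows "(f, g) \<in> T \<Longrightarrow> f \<in> K" "(f, g) \<in> T \<Longrightarrow> g \<in> K" "(0, 0) \<in> T"
    "(f, g) \<in> T \<Longrightarrow> (f, g') \<in> T \<Longrightarrow> g = g'"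
    "(f, g) \<in> T \<Longrightarrow> (f', g') \<in> T \<Longrightarrow> (f + f', g + g') \<in> T"
    "(f, g) \<in> T \<Longrightarrow> (c *\<^sub>C f, c *\<^sub>C g) \<in> T"
  using assms unfolding operator_in_def single_valued_def by blast+

lemma operator_in_diff:
  assumes "operator_in K T" "(f, g) \<in> T" "(f', g') \<in> T"
  shows "(f - f', g - g') \<in> T"
  using operator_inD(5)[OF assms(1,2) operator_inD(6)[OF assms(1,3), of "-1"]]
  by (simp add: complex_vector.scale_minus_left)

lemma symmetricD: "symmetric T \<Longrightarrow> (f, g) \<in> T \<Longrightarrow> (f', g') \<in> T \<Longrightarrow> cinner g f' = cinner f g'"
  unfolding symmetric_def by blast

lemma mem_Range_add_scalar: "y \<in> Range (add_scalar T c) \<longleftrightarrow> (\<exists>f g. (f, g) \<in> T \<and> y = g + c *\<^sub>C f)"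
  by (auto simp: add_scalar_def)

lemma Range_add_scalarI: "(f, g) \<in> T \<Longrightarrow> g + c *\<^sub>C f \<in> Range (add_scalar T c)"
  unfolding mem_Range_add_scalar by blast

lemma csubspace_Domain: "operator_in K T \<Longrightarrow> csubspace (Domain T)"
  unfolding complex_vector.subspace_def using operator_inD(3,5,6)[of K T] by fast

lemma csubspace_Range_add_scalar:
  assumes T: "operator_in K T"
  shows "csubspace (Range (add_scalar T c))"
proof (rule complex_vector.subspaceI)
  show "0 \<in> Range (add_scalar T c)"
    unfolding mem_Range_add_scalar using operator_inD(3)[OF T] by force
next
  fix x y assume "x \<in> Range (add_scalar T c)" "y \<in> Range (add_scalar T c)"
  then obtain f g f' g' where fg: "(f, g) \<in> T" "x = g + c *\<^sub>C f" "(f', g') \<in> T" "y = g' + c *\<^sub>C f'"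
    unfolding mem_Range_add_scalar by blast
  then have "x + y = (g + g') + c *\<^sub>C (f + f')"
    by (simp add: scaleC_add_right)
  then show "x + y \<in> Range (add_scalar T c)"
    unfolding mem_Range_add_scalar using operator_inD(5)[OF T fg(1,3)] by blast
next
  fix a x assume "x \<in> Range (add_scalar T c)"
  then obtain f g where fg: "(f, g) \<in> T" "x = g + c *\<^sub>C f"
    unfolding mem_Range_add_scalar by blast
  then have "a *\<^sub>C x = a *\<^sub>C g + c *\<^sub>C (a *\<^sub>C f)"
    by (simp add: scaleC_add_right scaleC_scaleC mult.commute)
  then show "a *\<^sub>C x \<in> Range (add_scalar T c)"
    unfolding mem_Range_add_scalar using operator_inD(6)[OF T fg(1)] by blast
qed

text \<open>The mixed terms of the squared norm cancel by symmetry, so the graph with its product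
  norm is mapped isometrically onto the range of the shifted operator.\<close>

lemma symmetric_norm_add_scalar:
  assumes "symmetric T" "(f, g) \<in> T" and c: "c = \<i> \<or> c = - \<i>"
  shows "norm (g + c *\<^sub>C f) = norm (f, g)"
proof -
  have "complex_of_real ((norm (g + c *\<^sub>C f))\<^sup>2) = complex_of_real ((norm f)\<^sup>2 + (norm g)\<^sup>2)"
    unfolding cinner_self[symmetric] of_real_add
    using symmetricD[OF assms(1,2,2)] c by (auto simp: cinner_simps algebra_simps)
  then have "(norm (g + c *\<^sub>C f))\<^sup>2 = (norm f)\<^sup>2 + (norm g)\<^sup>2"
    by (simp only: of_real_eq_iff)
  then show ?thesis
    unfolding norm_Pair by (metis norm_ge_zero real_sqrt_unique)
qed

text \<open>A closed graph is complete, hence so is its isometric image.\<close>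

lemma closed_csubspace_Range_add_scalar:
  fixes T :: "'a::complex_hilbert operator"
  assumes T: "operator_in K T" "closed T" "symmetric T" and c: "c = \<i> \<or> c = - \<i>"
  shows "closed_csubspace (Range (add_scalar T c))"
proof -
  define F where "F p = snd p + c *\<^sub>C fst p" for p :: "'a \<times> 'a"
  have F: "Range (add_scalar T c) = F ` T"
    by (rule set_eqI) (simp only: mem_Range_add_scalar image_iff Bex_def split_paired_Ex F_def fst_conv snd_conv)
  have "complete (F ` T)"
  proof (rule complete_isometric_image[of 1])
    show "subspace T"
      using operator_inD(3,5,6)[OF T(1)]
      unfolding subspace_def by (auto simp: zero_prod_def scaleR_eq_scaleC)
    show "bounded_linear F"
      unfolding F_def
      by (intro bounded_linear_add bounded_linear_snd bounded_linear_compose[OF bounded_linear_scaleC bounded_linear_fst])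
    show "\<forall>p\<in>T. 1 * norm p \<le> norm (F p)"
      using symmetric_norm_add_scalar[OF T(3) _ c] by (auto simp: F_def)
    show "complete T"
      using T(2) by (simp add: complete_eq_closed)
  qed simp
  then show ?thesis
    using csubspace_Range_add_scalar[OF T(1), of c]
    by (simp add: closed_csubspace_def F complete_eq_closed)
qed

text \<open>The graph of \<open>G\<close> is closed, hence so is the range of \<open>G - c\<close>.
  A vector \<open>q\<close> orthogonal to that range satisfies
  \<open>cinner q (G q) = cnj c * cinner q q\<close>, real on the left and imaginary on the right,
  so \<open>q = 0\<close>. Multiplying \<open>G x - c x\<close> by \<open>c\<close> then gives
  \<open>x + c G x\<close>, because \<open>c * c = -1\<close>.\<close>

lemma symmetric_plus_scalar_surj:
  fixes G :: "'a::{complex_hilbert, second_countable_topology} \<Rightarrow> 'a"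
  assumes G: "clinear G" "\<And>x y. cinner (G x) y = cinner x (G y)" and c: "c = \<i> \<or> c = - \<i>"
  shows "\<exists>x. x + c *\<^sub>C G x = z"
proof -
  define T where "T = range (\<lambda>x. (x, G x))"
  \<comment> \<open>Testing symmetry against every \<open>z\<close> writes the graph as an
    intersection of closed sets, with no appeal to continuity of \<open>G\<close>.\<close>
  have eqT: "T = (\<Inter>z. {p. cinner (snd p) z = cinner (fst p) (G z)})"
  proof (intro equalityI subsetI)
    fix p assume "p \<in> (\<Inter>z. {p. cinner (snd p) z = cinner (fst p) (G z)})"
    then have "cinner (snd p - G (fst p)) z = 0" for z
      by (simp add: cinner_simps G(2))
    then have "snd p = G (fst p)"
      using cinner_self_eq_0 right_minus_eq by blast
    then show "p \<in> T"
      unfolding T_def by (metis prod.collapse rangeI)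
  qed (auto simp: T_def G(2))
  have "closed T"
    unfolding eqT by (intro closed_INT ballI closed_Collect_eq continuous_on_cinner continuous_intros)
  moreover have op: "operator_in UNIV T"
    by (auto simp: operator_in_def T_def single_valued_def clinear_simps[OF G(1)] image_iff)
  moreover have "symmetric T"
    by (auto simp: symmetric_def T_def G(2))
  ultimately have clo: "closed_csubspace (Range (add_scalar T (- c)))"
    using c by (intro closed_csubspace_Range_add_scalar) auto
  obtain p q where pq: "(- c) *\<^sub>C z = p + q" "p \<in> Range (add_scalar T (- c))"
      "q \<in> UNIV \<ominus> Range (add_scalar T (- c))"
    using clo by (rule orthogonal_decomposition[where x = "(- c) *\<^sub>C z" and K = UNIV]) auto
  have "(q, G q) \<in> T"
    by (simp add: T_def)
  then have "cinner q (G q + (- c) *\<^sub>C q) = 0"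
    using pq(3) Range_add_scalarI unfolding orth_diff_def by blast
  then have eq: "cinner q (G q) = cnj c * cinner q q"
    by (simp add: cinner_simps)
  have "cinner q (G q) = cnj (cinner q (G q))"
    using G(2)[of q q] by (simp add: cinner_commute[of q "G q"])
  then have "cinner q q = 0"
    unfolding eq using c by (auto simp: cinner_self)
  then have "q = 0" by simp
  then obtain x where "(- c) *\<^sub>C z = G x + (- c) *\<^sub>C x"
    using pq(1,2) unfolding mem_Range_add_scalar T_def by auto
  then have "c *\<^sub>C ((- c) *\<^sub>C z) = c *\<^sub>C (G x + (- c) *\<^sub>C x)"
    by simp
  moreover have "c * - c = 1"
    using c by auto
  ultimately have "z = x + c *\<^sub>C G x"
    by (simp only: scaleC_add_right scaleC_scaleC scaleC_one add.commute)
  then show ?thesis by metis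
qed

section \<open>Selfadjointness and maximal dissipativity from full ranges\<close>

lemma symmetricI_Cayley:
  assumes "\<And>f g f' g'. (f, g) \<in> T \<Longrightarrow> (f', g') \<in> T \<Longrightarrow>
    cinner (g + \<i> *\<^sub>C f) (g' + \<i> *\<^sub>C f') = cinner (g - \<i> *\<^sub>C f) (g' - \<i> *\<^sub>C f')"
  shows "symmetric T"
  unfolding symmetric_def
proof (intro ballI, clarify)
  fix f g f' g' assume "(f, g) \<in> T" "(f', g') \<in> T"
  \<comment> \<open>The two sides differ by \<open>2 * \<i>\<close> times the defect of symmetry, so
    an isometric Cayley transform means a symmetric operator.\<close>
  from assms[OF this] have "2 * \<i> * (cinner f g' - cinner g f') = 0"
    by (simp add: cinner_simps algebra_simps)
  then show "cinner g f' = cinner f g'"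
    by simp
qed

text \<open>Vectors are written as \<open>v + \<i> u\<close> with \<open>(u, v)\<close> in
  \<open>T\<close>. If such a vector is orthogonal to the domain, pairing it with \<open>u\<close>
  gives \<open>u = 0\<close>. For \<open>(h, k)\<close> in the adjoint and
  \<open>k + \<i> h = v + \<i> u\<close>, the difference \<open>h - u\<close> is orthogonal to the
  full range of \<open>T - \<i>\<close>.\<close>

lemma selfadjoint_inI:
  fixes T :: "'a::{complex_hilbert, second_countable_topology} operator"
  assumes T: "operator_in UNIV T" "symmetric T"
    and ran: "Range (add_scalar T \<i>) = UNIV" "Range (add_scalar T (- \<i>)) = UNIV"
  shows "selfadjoint_in UNIV T"
  unfolding selfadjoint_in_def
proof (intro conjI)
  show "operator_in UNIV T" by (rule T)
  show "densely_defined_in UNIV T"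
    unfolding densely_defined_in_def
  proof
    fix x :: 'a
    have "closed_csubspace (closure (Domain T))"
      using csubspace_closure[OF csubspace_Domain[OF T(1)]] by (simp add: closed_csubspace_def)
    then obtain p q where pq: "x = p + q" "p \<in> closure (Domain T)" "q \<in> UNIV \<ominus> closure (Domain T)"
      by (rule orthogonal_decomposition[where x = x and K = UNIV]) auto
    obtain u v where uv: "(u, v) \<in> T" "q = v + \<i> *\<^sub>C u"
      using ran(1) mem_Range_add_scalar[of q T \<i>] by auto
    have "u \<in> closure (Domain T)"
      using uv(1) closure_subset[of "Domain T"] by blast
    then have "cinner v u + \<i> * cinner u u = 0"
      using pq(3) uv(2) by (auto simp: orth_diff_def cinner_simps)
    moreover have "Im (cinner v u) = 0"
      using symmetricD[OF T(2) uv(1,1)] cinner_commute[of v u]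
      by (metis complex_cnj_cancel_iff cnj.sel(2) neg_equal_zero)
    ultimately have "u = 0"
      by (simp add: complex_eq_iff cinner_self)
    then have "q = 0"
      using operator_inD(4)[OF T(1) _ operator_inD(3)[OF T(1)], of v] uv by simp
    then show "x \<in> closure (Domain T)"
      using pq by simp
  qed
  show "adjoint_in UNIV T = T"
  proof (intro equalityI subrelI)
    fix h k assume "(h, k) \<in> T"
    then show "(h, k) \<in> adjoint_in UNIV T"
      using symmetricD[OF T(2)] by (auto simp: adjoint_in_def)
  next
    fix h k assume "(h, k) \<in> adjoint_in UNIV T"
    then have hk: "cinner g h = cinner f k" if "(f, g) \<in> T" for f g
      using that by (auto simp: adjoint_in_def)
    obtain u v where uv: "(u, v) \<in> T" "k + \<i> *\<^sub>C h = v + \<i> *\<^sub>C u"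
      using ran(1) mem_Range_add_scalar[of "k + \<i> *\<^sub>C h" T \<i>] by auto
    have k: "k - v = - (\<i> *\<^sub>C (h - u))"
      using uv(2) by (simp add: complex_vector.scale_right_diff_distrib algebra_simps)
    have "cinner (g + (- \<i>) *\<^sub>C f) (h - u) = 0" if fg: "(f, g) \<in> T" for f g
    proof -
      have "cinner g (h - u) = cinner f (k - v)"
        using hk[OF fg] symmetricD[OF T(2) fg uv(1)] by (simp add: cinner_simps)
      then show ?thesis
        unfolding k by (simp add: cinner_minus_right cinner_scaleC_right cinner_diff_left cinner_scaleC_left)
    qed
    then have "cinner y (h - u) = 0" for y
      using ran(2) mem_Range_add_scalar[of y T "- \<i>"] by blast
    then have "h = u"
      using cinner_self_eq_0 right_minus_eq by blast
    then show "(h, k) \<in> T"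
      using k uv(1) by simp
  qed
qed

text \<open>For \<open>(h, k)\<close> in a dissipative extension, pick \<open>(u, v)\<close> in
  \<open>T\<close> with the same value of \<open>k + \<i> h\<close>. If nonzero,
  \<open>h - u\<close> would be an eigenvector of the extension for -\<i>, which dissipativity
  excludes.\<close>

lemma maximal_dissipative_inI:
  assumes T: "operator_in UNIV T" "symmetric T" and ran: "Range (add_scalar T \<i>) = UNIV"
  shows "maximal_dissipative_in UNIV T"
  unfolding maximal_dissipative_in_def
proof (intro conjI notI)
  have "Im (cinner g f) = 0" if "(f, g) \<in> T" for f g
    using symmetricD[OF T(2) that that] cinner_commute[of g f]
    by (metis complex_cnj_cancel_iff cnj.sel(2) neg_equal_zero)
  then show "dissipative_in UNIV T"
    using T(1) by (auto simp: dissipative_in_def)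
next
  assume "\<exists>T'. dissipative_in UNIV T' \<and> T \<subset> T'"
  then obtain T' where dis: "dissipative_in UNIV T'" and sub: "T \<subset> T'"
    by blast
  then obtain h k where hk: "(h, k) \<in> T'" "(h, k) \<notin> T"
    by auto
  have T': "operator_in UNIV T'" "Im (cinner g f) \<ge> 0" if "(f, g) \<in> T'" for f g
    using dis that by (auto simp: dissipative_in_def)
  obtain u v where uv: "(u, v) \<in> T" "k + \<i> *\<^sub>C h = v + \<i> *\<^sub>C u"
    using ran mem_Range_add_scalar[of "k + \<i> *\<^sub>C h" T \<i>] by auto
  have k: "k - v = - (\<i> *\<^sub>C (h - u))"
    using uv(2) by (simp add: complex_vector.scale_right_diff_distrib algebra_simps)
  have "(h - u, k - v) \<in> T'"
    using operator_in_diff[OF T'(1)[OF hk(1)] hk(1)] uv(1) sub by blast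
  then have "Im (cinner (k - v) (h - u)) \<ge> 0"
    by (rule T'(2))
  then have "h = u"
    unfolding k by (simp add: cinner_minus_left cinner_scaleC_left cinner_self power2_less_0 flip: of_real_power)
  then show False
    using k uv(1) hk(2) by simp
qed

section \<open>Von Neumann's decomposition and the construction of the extension\<close>

text \<open>
  \<open>K\<^sub>+\<close> and \<open>K\<^sub>-\<close> are the eigenspaces of the adjoint of \<open>S\<close> for
  \<open>\<i>\<close> and \<open>- \<i>\<close>; applying the adjoint to the vanishing sum gives a second linear relation.
\<close>

lemma von_Neumann_direct:
  assumes H: "csubspace H" and S: "operator_in H S" "densely_defined_in H S" "symmetric S"
    and sS: "(s, s') \<in> S"
    and kp: "kp \<in> H \<ominus> Range (add_scalar S \<i>)" and km: "km \<in> H \<ominus> Range (add_scalar S (- \<i>))"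
    and sum: "s + kp + km = 0"
  shows "kp = 0" "km = 0" "s = 0"
proof -
  have kpH: "kp \<in> H" and kmH: "km \<in> H"
    using kp km by (auto simp: orth_diff_def)
  have orth: "cinner kp (g + \<i> *\<^sub>C f) = 0" "cinner km (g + (- \<i>) *\<^sub>C f) = 0" if "(f, g) \<in> S" for f g
    using kp km that unfolding orth_diff_def mem_Collect_eq mem_Range_add_scalar Ball_def by blast+
  \<comment> \<open>\<open>w\<close> is the adjoint of \<open>S\<close> applied to
    \<open>s + kp + km\<close>; testing it against the dense domain shows that it vanishes.\<close>
  define w where "w = s' + \<i> *\<^sub>C kp - \<i> *\<^sub>C km"
  have "w = 0"
  proof (rule orthogonal_to_dense)
    show "H \<subseteq> closure (Domain S)"
      using S(2) by (simp add: densely_defined_in_def)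
    show "w \<in> H"
      using operator_inD(2)[OF S(1) sS] H kpH kmH
      by (simp add: w_def complex_vector.subspace_add complex_vector.subspace_diff complex_vector.subspace_scale)
    fix f assume "f \<in> Domain S"
    then obtain g where fg: "(f, g) \<in> S" by blast
    have "cinner (s + kp + km) g = 0"
      by (simp add: sum)
    moreover have "cinner s g = cinner s' f"
      using symmetricD[OF S(3) sS fg] by simp
    moreover have "cinner kp g = \<i> * cinner kp f" "cinner km g = - (\<i> * cinner km f)"
      using orth[OF fg] by (simp_all add: cinner_simps eq_neg_iff_add_eq_0)
    ultimately show "cinner w f = 0"
      by (simp add: w_def cinner_simps)
  qed
  \<comment> \<open>The two relations express \<open>s\<close> and \<open>s'\<close> through
    \<open>kp\<close> and \<open>km\<close>. Then \<open>s' + \<i> s\<close> is a multiple of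
    \<open>kp\<close> and \<open>s' - \<i> s\<close> one of \<open>km\<close>, so each of these is
    orthogonal to itself.\<close>
  have "s = (s + kp + km) - kp - km"
    by simp
  then have s: "s = - kp - km"
    unfolding sum by simp
  have "s' = w - \<i> *\<^sub>C kp + \<i> *\<^sub>C km"
    by (simp add: w_def)
  then have s': "s' = \<i> *\<^sub>C km - \<i> *\<^sub>C kp"
    unfolding \<open>w = 0\<close> by simp
  have "cinner kp (s' + \<i> *\<^sub>C s) = cinner kp ((- 2 * \<i>) *\<^sub>C kp)"
    unfolding s s' by (simp add: cinner_simps algebra_simps)
  then have "cinner kp kp = 0"
    using orth(1)[OF sS] by (simp add: cinner_simps)
  then show kp0: "kp = 0" by simp
  have "cinner km (s' + (- \<i>) *\<^sub>C s) = cinner km ((2 * \<i>) *\<^sub>C km)"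
    unfolding s s' by (simp add: cinner_simps algebra_simps)
  then have "cinner km km = 0"
    using orth(2)[OF sS] by (simp add: cinner_simps)
  then show "km = 0" by simp
  then show "s = 0" using s kp0 by simp
qed

text \<open>Symmetry and the two full ranges are the data from which \<open>selfadjoint_inI\<close>
  and \<open>maximal_dissipative_inI\<close> draw their conclusions. The graph is parametrised by
  the elements of \<open>S\<close> and by pairs \<open>(a, b)\<close> from
  \<open>H1\<close>.\<close>

lemma exists_symmetric_extension:
  fixes H H1 :: "'a :: {complex_hilbert, second_countable_topology} set"
    and S :: "'a operator"
  assumes H: "closed_csubspace H"
    and H1: "H1 = UNIV \<ominus> H" "hdim H1 = \<infinity>"
    and S: "operator_in H S" "densely_defined_in H S" "closed S" "symmetric S"
    and def: "deficiency_plus H S = \<infinity>" "deficiency_minus H S = \<infinity>"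
  obtains T where "operator_in UNIV T" "symmetric T"
    "Range (add_scalar T \<i>) = UNIV" "Range (add_scalar T (- \<i>)) = UNIV"
    "S \<subseteq> T" "Domain T \<inter> H = Domain S" "Domain T \<inter> H1 = {0}"
proof -
  have Hsub: "csubspace H"
    using H by (simp add: closed_csubspace_def)
  have H1cl: "closed_csubspace H1"
    unfolding H1(1) by (rule closed_csubspace_orth_diff) (simp add: closed_csubspace_def)
  then have H1sub: "csubspace H1"
    by (simp add: closed_csubspace_def)
  note Hs = complex_vector.subspace_add[OF Hsub] complex_vector.subspace_diff[OF Hsub]
    complex_vector.subspace_scale[OF Hsub] complex_vector.subspace_0[OF Hsub]
  note H1s = complex_vector.subspace_add[OF H1sub] complex_vector.subspace_diff[OF H1sub]
    complex_vector.subspace_scale[OF H1sub] complex_vector.subspace_0[OF H1sub]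
    complex_vector.subspace_neg[OF H1sub]
  have orth: "cinner y x = 0" "cinner x y = 0" if "x \<in> H" "y \<in> H1" for x y
  proof -
    show "cinner y x = 0"
      using that unfolding H1(1) orth_diff_def by blast
    then show "cinner x y = 0"
      by (simp add: cinner_commute[of x y])
  qed
  have meet: "x = 0" if "x \<in> H" "x \<in> H1" for x
    using orth(1)[OF that] by simp
  define Kp where "Kp = H \<ominus> Range (add_scalar S \<i>)"
  define Km where "Km = H \<ominus> Range (add_scalar S (- \<i>))"
  have Kp: "closed_csubspace Kp" "hdim Kp = \<infinity>" "Kp \<subseteq> H"
    and Km: "closed_csubspace Km" "hdim Km = \<infinity>" "Km \<subseteq> H"
    using closed_csubspace_orth_diff[OF H] def
    by (auto simp: Kp_def Km_def deficiency_plus_def deficiency_minus_def orth_diff_def)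
  obtain \<phi> where \<phi>: "clinear \<phi>" "\<And>x. \<phi> x \<in> Kp"
      "\<And>x y. x \<in> H1 \<Longrightarrow> y \<in> H1 \<Longrightarrow> cinner (\<phi> x) (\<phi> y) = cinner x y" "\<phi> ` H1 = Kp"
    using exists_unitary[OF H1cl H1(2) Kp(1,2)] by metis
  obtain \<psi> where \<psi>: "clinear \<psi>" "\<And>x. \<psi> x \<in> Km"
      "\<And>x y. x \<in> H1 \<Longrightarrow> y \<in> H1 \<Longrightarrow> cinner (\<psi> x) (\<psi> y) = cinner x y" "\<psi> ` H1 = Km"
    using exists_unitary[OF H1cl H1(2) Km(1,2)] by metis
  obtain P Q where PQ: "clinear P" "clinear Q" "\<And>x. P x \<in> H1" "\<And>x. Q x \<in> H1"
    and symP: "\<And>x y. cinner (P x) y = cinner x (P y)" and symQ: "\<And>x y. cinner (Q x) y = cinner x (Q y)"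
    and disj: "\<And>x y. x \<in> H1 \<Longrightarrow> y \<in> H1 \<Longrightarrow> P x = Q y \<Longrightarrow> x = 0 \<and> y = 0"
    using exists_symmetric_disjoint_ranges[OF H1cl H1(2)] by metis
  note lin = clinear_simps[OF \<phi>(1)] clinear_simps[OF \<psi>(1)] clinear_simps[OF PQ(1)] clinear_simps[OF PQ(2)]
  note scale_simps = scaleC_add_right complex_vector.scale_right_diff_distrib scaleC_scaleC
    complex_vector.scale_minus_right complex_vector.scale_minus_left
  \<comment> \<open>\<open>A\<close> and \<open>B\<close> are the sum and the difference of
    \<open>a + c P a\<close> and \<open>b + c Q b\<close>. The unitary takes their values at
    \<open>c = \<i>\<close> to those at \<open>c = - \<i>\<close>, so no inverse of
    \<open>1 + \<i> P\<close> has to be written down.\<close>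
  define A where "A c a b = a + b + c *\<^sub>C (P a + Q b)" for c a b
  define B where "B c a b = a - b + c *\<^sub>C (P a - Q b)" for c a b
  have AB_H1: "A c a b \<in> H1" "B c a b \<in> H1" if "a \<in> H1" "b \<in> H1" for c a b
    using that PQ(3,4) by (simp_all add: A_def B_def H1s)
  have AB_add: "A c (a + a') (b + b') = A c a b + A c a' b'" "B c (a + a') (b + b') = B c a b + B c a' b'"
    and AB_scale: "A c (d *\<^sub>C a) (d *\<^sub>C b) = d *\<^sub>C A c a b" "B c (d *\<^sub>C a) (d *\<^sub>C b) = d *\<^sub>C B c a b"
    and AB_0: "A c 0 0 = 0" "B c 0 0 = 0" for a a' b b' c d
    by (simp_all add: A_def B_def lin scale_simps algebra_simps)
  \<comment> \<open>Half the sum and half the difference of the targets decouple the system into one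
    equation for \<open>a\<close> and one for \<open>b\<close>.\<close>
  have AB_surj: "\<exists>a\<in>H1. \<exists>b\<in>H1. A c a b = \<alpha> \<and> B c a b = \<beta>"
    if c: "c = \<i> \<or> c = - \<i>" and "\<alpha> \<in> H1" "\<beta> \<in> H1" for c \<alpha> \<beta>
  proof -
    obtain a where a: "a + c *\<^sub>C P a = (1/2) *\<^sub>C (\<alpha> + \<beta>)"
      using symmetric_plus_scalar_surj[OF PQ(1) symP c] by blast
    obtain b where b: "b + c *\<^sub>C Q b = (1/2) *\<^sub>C (\<alpha> - \<beta>)"
      using symmetric_plus_scalar_surj[OF PQ(2) symQ c] by blast
    have "a = (1/2) *\<^sub>C (\<alpha> + \<beta>) - c *\<^sub>C P a" "b = (1/2) *\<^sub>C (\<alpha> - \<beta>) - c *\<^sub>C Q b"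
      using a b by (simp_all add: algebra_simps)
    then have "a \<in> H1" "b \<in> H1"
      using that PQ(3,4) H1s by metis+
    moreover have "A c a b = (a + c *\<^sub>C P a) + (b + c *\<^sub>C Q b)" "B c a b = (a + c *\<^sub>C P a) - (b + c *\<^sub>C Q b)"
      by (simp_all add: A_def B_def scale_simps algebra_simps)
    then have "A c a b = (1/2 + 1/2) *\<^sub>C \<alpha>" "B c a b = (1/2 + 1/2) *\<^sub>C \<beta>"
      unfolding a b by (simp_all only: scale_simps scaleC_add_left) simp_all
    then have "A c a b = \<alpha>" "B c a b = \<beta>"
      by (simp_all add: scaleC_one)
    ultimately show ?thesis by blast
  qed
  \<comment> \<open>Adding the two products cancels the mixed terms between \<open>a\<close> and
    \<open>b\<close> parts; symmetry of \<open>P\<close> and \<open>Q\<close> makes the rest the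
    same for both signs.\<close>
  have AB_inner: "cinner (A \<i> a b) (A \<i> a' b') + cinner (B \<i> a b) (B \<i> a' b')
      = cinner (A (- \<i>) a b) (A (- \<i>) a' b') + cinner (B (- \<i>) a b) (B (- \<i>) a' b')" for a b a' b'
    unfolding A_def B_def
    by (simp add: cinner_simps symP symQ algebra_simps)
  \<comment> \<open>Let \<open>k\<close> be \<open>\<phi> (A \<i> a b) + B \<i> a b\<close> and
    \<open>k'\<close> its image under the unitary. By von Neumann's formula \<open>F\<close> is
    \<open>s + k - k'\<close> and \<open>G\<close> is \<open>s' + \<i> (k + k')\<close>.\<close>
  define F where "F s a b = s + \<phi> (A \<i> a b) - \<psi> (A (- \<i>) a b) + (B \<i> a b - B (- \<i>) a b)" for s a b
  define G where "G s' a b = s' + \<i> *\<^sub>C (\<phi> (A \<i> a b) + \<psi> (A (- \<i>) a b) + (B \<i> a b + B (- \<i>) a b))" for s' a b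
  define T where "T = {(F s a b, G s' a b) | s s' a b. (s, s') \<in> S \<and> a \<in> H1 \<and> b \<in> H1}"
  have T_I: "(F s a b, G s' a b) \<in> T" if "(s, s') \<in> S" "a \<in> H1" "b \<in> H1" for s s' a b
    using that unfolding T_def by blast
  have T_E: thesis
    if "(f, g) \<in> T" "\<And>s s' a b. (s, s') \<in> S \<Longrightarrow> a \<in> H1 \<Longrightarrow> b \<in> H1 \<Longrightarrow> f = F s a b \<Longrightarrow> g = G s' a b \<Longrightarrow> thesis"
    for f g thesis
    using that unfolding T_def by blast
  have FG_0: "F s 0 0 = s" "G s 0 0 = s" for s
    by (simp_all add: F_def G_def AB_0 lin)
  have plus: "G s' a b + \<i> *\<^sub>C F s a b = (s' + \<i> *\<^sub>C s) + (2 * \<i>) *\<^sub>C (\<phi> (A \<i> a b) + B \<i> a b)"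
    and minus: "G s' a b - \<i> *\<^sub>C F s a b = (s' - \<i> *\<^sub>C s) + (2 * \<i>) *\<^sub>C (\<psi> (A (- \<i>) a b) + B (- \<i>) a b)"
    for s s' a b
    unfolding F_def G_def mult_2 scaleC_add_left by (simp_all add: scale_simps algebra_simps)
  have B_diff: "B \<i> a b - B (- \<i>) a b = (2 * \<i>) *\<^sub>C (P a - Q b)" for a b
    unfolding B_def mult_2 scaleC_add_left by (simp add: scale_simps algebra_simps)
  have A_diff: "A \<i> a b - A (- \<i>) a b = (2 * \<i>) *\<^sub>C (P a + Q b)" for a b
    unfolding A_def mult_2 scaleC_add_left by (simp add: scale_simps algebra_simps)
  have H_part: "s + \<phi> (A \<i> a b) - \<psi> (A (- \<i>) a b) \<in> H" if "(s, s') \<in> S" for s s' a b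
    using \<phi>(2) \<psi>(2) Kp(3) Km(3) operator_inD(1)[OF S(1) that] by (intro Hs) auto
  \<comment> \<open>The component of \<open>F\<close> in \<open>H1\<close> is a multiple of
    \<open>P a - Q b\<close> and has to vanish.\<close>
  have in_H: "a = 0" "b = 0" if "(s, s') \<in> S" "a \<in> H1" "b \<in> H1" "F s a b \<in> H" for s s' a b
  proof -
    have "F s a b - (s + \<phi> (A \<i> a b) - \<psi> (A (- \<i>) a b)) \<in> H"
      using that(4) H_part[OF that(1)] by (rule Hs)
    then have "B \<i> a b - B (- \<i>) a b \<in> H"
      by (simp add: F_def)
    then have "B \<i> a b - B (- \<i>) a b = 0"
      using AB_H1[OF that(2,3)] by (intro meet H1s)
    then have "P a = Q b"
      unfolding B_diff by simp
    then show "a = 0" "b = 0"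
      using disj that(2,3) by auto
  qed
  \<comment> \<open>Now the component in \<open>H\<close> has to vanish. Directness of von Neumann's
    decomposition and injectivity of \<open>\<phi>\<close> and \<open>\<psi>\<close> on
    \<open>H1\<close> kill both values of \<open>A\<close>, and their difference yields
    \<open>P a = Q (- b)\<close>.\<close>
  have in_H1: "F s a b = 0" if sS: "(s, s') \<in> S" and ab: "a \<in> H1" "b \<in> H1" and FH1: "F s a b \<in> H1" for s s' a b
  proof -
    have "F s a b - (B \<i> a b - B (- \<i>) a b) \<in> H1"
      using FH1 AB_H1[OF ab] by (intro H1s)
    then have sum: "s + \<phi> (A \<i> a b) - \<psi> (A (- \<i>) a b) = 0"
      using H_part[OF sS] by (intro meet) (simp_all add: F_def)
    have "- \<psi> (A (- \<i>) a b) \<in> Km"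
      using Km(1) \<psi>(2) by (simp add: closed_csubspace_def complex_vector.subspace_neg)
    then have vN: "\<phi> (A \<i> a b) = 0" "- \<psi> (A (- \<i>) a b) = 0" "s = 0"
      using von_Neumann_direct[OF Hsub S(1,2,4) sS, folded Kp_def Km_def,
          of "\<phi> (A \<i> a b)" "- \<psi> (A (- \<i>) a b)"] \<phi>(2)[of "A \<i> a b"] sum
      unfolding diff_conv_add_uminus by blast+
    have "A \<i> a b = 0" "A (- \<i>) a b = 0"
      using \<phi>(3)[of "A \<i> a b" "A \<i> a b"] \<psi>(3)[of "A (- \<i>) a b" "A (- \<i>) a b"] AB_H1[OF ab] vN by simp_all
    then have "P a = Q (- b)"
      using A_diff[of a b] by (simp add: lin eq_neg_iff_add_eq_0)
    then have "a = 0 \<and> - b = 0"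
      using ab by (intro disj H1s)
    then show ?thesis
      using vN(3) FG_0 by simp
  qed
  have T_add: "(f + f', g + g') \<in> T" if "(f, g) \<in> T" "(f', g') \<in> T" for f g f' g'
  proof (rule T_E[OF that(1)], rule T_E[OF that(2)])
    fix s s' a b t t' c d
    assume *: "(s, s') \<in> S" "a \<in> H1" "b \<in> H1" "f = F s a b" "g = G s' a b"
      "(t, t') \<in> S" "c \<in> H1" "d \<in> H1" "f' = F t c d" "g' = G t' c d"
    have "f + f' = F (s + t) (a + c) (b + d)" "g + g' = G (s' + t') (a + c) (b + d)"
      by (simp_all add: * F_def G_def AB_add lin scale_simps algebra_simps)
    then show ?thesis
      using T_I[OF operator_inD(5)[OF S(1) *(1,6)] H1s(1)[OF *(2,7)] H1s(1)[OF *(3,8)]] by simp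
  qed
  have T_scale: "(c *\<^sub>C f, c *\<^sub>C g) \<in> T" if "(f, g) \<in> T" for c f g
  proof (rule T_E[OF that])
    fix s s' a b
    assume *: "(s, s') \<in> S" "a \<in> H1" "b \<in> H1" "f = F s a b" "g = G s' a b"
    have "c *\<^sub>C f = F (c *\<^sub>C s) (c *\<^sub>C a) (c *\<^sub>C b)" "c *\<^sub>C g = G (c *\<^sub>C s') (c *\<^sub>C a) (c *\<^sub>C b)"
      by (simp_all add: * F_def G_def AB_scale lin scale_simps algebra_simps)
    then show ?thesis
      using T_I[OF operator_inD(6)[OF S(1) *(1)] H1s(3)[OF *(2)] H1s(3)[OF *(3)]] by simp
  qed
  \<comment> \<open>As 0 lies in \<open>H\<close>, the parameters \<open>a\<close> and
    \<open>b\<close> vanish, and single-valuedness of \<open>S\<close> decides.\<close>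
  have T_fun: "g = 0" if "(0, g) \<in> T" for g
  proof (rule T_E[OF that])
    fix s s' a b
    assume *: "(s, s') \<in> S" "a \<in> H1" "b \<in> H1" "0 = F s a b" "g = G s' a b"
    then have "a = 0" "b = 0"
      using in_H[OF *(1-3)] Hs(4) by simp_all
    then have "s = 0" "g = s'"
      using * FG_0 by simp_all
    then show "g = 0"
      using operator_inD(4)[OF S(1) _ operator_inD(3)[OF S(1)]] *(1) by simp
  qed
  have S_T: "S \<subseteq> T"
    using T_I[OF _ H1s(4) H1s(4)] FG_0 by auto
  have op: "operator_in UNIV T"
    unfolding operator_in_def
  proof (intro conjI)
    show "single_valued T"
    proof (rule single_valuedI)
      fix f g g' assume fg: "(f, g) \<in> T" "(f, g') \<in> T"
      have "(f + (- 1) *\<^sub>C f, g + (- 1) *\<^sub>C g') \<in> T"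
        using T_add[OF fg(1) T_scale[OF fg(2), of "- 1"]] .
      then have "(0, g - g') \<in> T"
        by (simp add: complex_vector.scale_minus_left)
      then show "g = g'"
        using T_fun by force
    qed
    show "(0, 0) \<in> T"
      using S_T operator_inD(3)[OF S(1)] by blast
  qed (use T_add T_scale in auto)
  have sym: "symmetric T"
  proof (rule symmetricI_Cayley, erule T_E, erule T_E, hypsubst)
    fix s s' a b t t' c d
    assume sS: "(s, s') \<in> S" and ab: "a \<in> H1" "b \<in> H1" and tS: "(t, t') \<in> S" and cd: "c \<in> H1" "d \<in> H1"
    have ranH: "s' + z *\<^sub>C s \<in> H" if "(s, s') \<in> S" for s s' z
      using operator_inD(1,2)[OF S(1) that] by (intro Hs)
    \<comment> \<open>The three parts lie in the shifted range of \<open>S\<close>, the deficiency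
      subspace and \<open>H1\<close>, which are mutually orthogonal; 4 is the squared modulus of
      \<open>2 * \<i>\<close>.\<close>
    have split: "cinner (r + (2 * \<i>) *\<^sub>C (k + h)) (r' + (2 * \<i>) *\<^sub>C (k' + h'))
        = cinner r r' + 4 * (cinner k k' + cinner h h')"
      if "r \<in> H" "r' \<in> H" "k \<in> H" "k' \<in> H" "h \<in> H1" "h' \<in> H1"
        "cinner k r' = 0" "cinner k' r = 0" for r r' k k' h h'
      using that(7,8) orth[OF that(1,6)] orth[OF that(2,5)] orth[OF that(3,6)] orth[OF that(4,5)]
        cinner_commute[of r k']
      by (simp add: cinner_simps algebra_simps)
    have Kp_orth: "cinner (\<phi> x) (s' + \<i> *\<^sub>C s) = 0" and Km_orth: "cinner (\<psi> x) (s' - \<i> *\<^sub>C s) = 0"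
      if "(s, s') \<in> S" for x s s'
      using \<phi>(2)[of x] \<psi>(2)[of x] Range_add_scalarI[OF that, of \<i>] Range_add_scalarI[OF that, of "- \<i>"]
      by (auto simp: Kp_def Km_def orth_diff_def complex_vector.scale_minus_left)
    have ranH': "s' - \<i> *\<^sub>C s \<in> H" if "(s, s') \<in> S" for s s'
      using operator_inD(1,2)[OF S(1) that] by (intro Hs)
    have \<phi>\<psi>H: "\<phi> x \<in> H" "\<psi> x \<in> H" for x
      using \<phi>(2) \<psi>(2) Kp(3) Km(3) by auto
    have "cinner (s' + \<i> *\<^sub>C s) (t' + \<i> *\<^sub>C t) = cinner (s' - \<i> *\<^sub>C s) (t' - \<i> *\<^sub>C t)"
      using symmetricD[OF S(4) sS tS] by (simp add: cinner_simps algebra_simps)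
    then show "cinner (G s' a b + \<i> *\<^sub>C F s a b) (G t' c d + \<i> *\<^sub>C F t c d)
        = cinner (G s' a b - \<i> *\<^sub>C F s a b) (G t' c d - \<i> *\<^sub>C F t c d)"
      unfolding plus minus
      using split[OF ranH[OF sS] ranH[OF tS] \<phi>\<psi>H(1) \<phi>\<psi>H(1) AB_H1(2)[OF ab] AB_H1(2)[OF cd]
          Kp_orth[OF tS] Kp_orth[OF sS]]
        split[OF ranH'[OF sS] ranH'[OF tS] \<phi>\<psi>H(2) \<phi>\<psi>H(2) AB_H1(2)[OF ab] AB_H1(2)[OF cd]
          Km_orth[OF tS] Km_orth[OF sS]]
        \<phi>(3)[OF AB_H1(1)[OF ab] AB_H1(1)[OF cd]] \<psi>(3)[OF AB_H1(1)[OF ab] AB_H1(1)[OF cd]]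
        AB_inner[of a b c d]
      by (simp only:)
  qed
  \<comment> \<open>Both signs are treated at once, \<open>\<theta>\<close> standing for
    \<open>\<phi>\<close> or \<open>\<psi>\<close>. The vector \<open>y\<close> is split along the
    range of \<open>S + c\<close>, its complement in \<open>H\<close>, and \<open>H1\<close>;
    \<open>AB_surj\<close> prescribes the last two components independently.\<close>
  have surj: "\<exists>s s' a b. (s, s') \<in> S \<and> a \<in> H1 \<and> b \<in> H1 \<and>
      y = (s' + c *\<^sub>C s) + (2 * \<i>) *\<^sub>C (\<theta> (A c a b) + B c a b)"
    if c: "c = \<i> \<or> c = - \<i>" and \<theta>: "\<theta> ` H1 = H \<ominus> Range (add_scalar S c)" for y c \<theta>
  proof -
    obtain h k where hk: "y = h + k" "h \<in> H" "k \<in> H1"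
      unfolding H1(1) by (rule orthogonal_decomposition[OF H, where x = y and K = UNIV]) auto
    have "Range (add_scalar S c) \<subseteq> H"
      unfolding subset_iff mem_Range_add_scalar using operator_inD(1,2)[OF S(1)] Hs by blast
    then obtain r \<kappa> where r: "h = r + \<kappa>" "r \<in> Range (add_scalar S c)" "\<kappa> \<in> H \<ominus> Range (add_scalar S c)"
      using orthogonal_decomposition[OF closed_csubspace_Range_add_scalar[OF S(1,3,4) c] Hsub _ hk(2)]
      by metis
    then obtain s s' where s: "(s, s') \<in> S" "r = s' + c *\<^sub>C s"
      unfolding mem_Range_add_scalar by blast
    have "(1 / (2 * \<i>)) *\<^sub>C \<kappa> \<in> \<theta> ` H1"
      unfolding \<theta> using csubspace_orth_diff[OF Hsub] r(3) by (rule complex_vector.subspace_scale)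
    then obtain \<alpha> where \<alpha>: "\<alpha> \<in> H1" "\<theta> \<alpha> = (1 / (2 * \<i>)) *\<^sub>C \<kappa>"
      by (metis imageE)
    obtain a b where ab: "a \<in> H1" "b \<in> H1" "A c a b = \<alpha>" "B c a b = (1 / (2 * \<i>)) *\<^sub>C k"
      using AB_surj[OF c \<alpha>(1) H1s(3)[OF hk(3)]] by blast
    have inv: "(2 * \<i>) *\<^sub>C (1 / (2 * \<i>)) *\<^sub>C x = x" for x :: 'a
      unfolding scaleC_scaleC by (simp add: scaleC_one)
    have "y = (s' + c *\<^sub>C s) + (2 * \<i>) *\<^sub>C (\<theta> (A c a b) + B c a b)"
      unfolding ab(3,4) \<alpha>(2) hk(1) r(1) s(2) scaleC_add_right inv by (simp only: add.assoc)
    then show ?thesis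
      using s(1) ab(1,2) by blast
  qed
  have ran_plus: "Range (add_scalar T \<i>) = UNIV"
  proof (intro equalityI subsetI UNIV_I)
    fix y :: 'a
    obtain s s' a b where "(s, s') \<in> S" "a \<in> H1" "b \<in> H1"
        "y = (s' + \<i> *\<^sub>C s) + (2 * \<i>) *\<^sub>C (\<phi> (A \<i> a b) + B \<i> a b)"
      using surj[of \<i> \<phi> y] \<phi>(4) unfolding Kp_def by blast
    then show "y \<in> Range (add_scalar T \<i>)"
      using Range_add_scalarI[OF T_I, of s s' a b \<i>] by (simp only: plus)
  qed
  have ran_minus: "Range (add_scalar T (- \<i>)) = UNIV"
  proof (intro equalityI subsetI UNIV_I)
    fix y :: 'a
    obtain s s' a b where s: "(s, s') \<in> S" "a \<in> H1" "b \<in> H1"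
        "y = (s' + (- \<i>) *\<^sub>C s) + (2 * \<i>) *\<^sub>C (\<psi> (A (- \<i>) a b) + B (- \<i>) a b)"
      using surj[of "- \<i>" \<psi> y] \<psi>(4) unfolding Km_def by blast
    have "y = G s' a b + (- \<i>) *\<^sub>C F s a b"
      using minus[of s' a b s] s(4) by (simp add: complex_vector.scale_minus_left)
    then show "y \<in> Range (add_scalar T (- \<i>))"
      using Range_add_scalarI[OF T_I[OF s(1-3)], of "- \<i>"] by (simp only:)
  qed
  have dom_H: "Domain T \<inter> H = Domain S"
  proof (intro equalityI subsetI)
    fix f assume f: "f \<in> Domain T \<inter> H"
    then obtain g where "(f, g) \<in> T" by blast
    then show "f \<in> Domain S"
    proof (rule T_E)
      fix s s' a b
      assume *: "(s, s') \<in> S" "a \<in> H1" "b \<in> H1" "f = F s a b"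
      then have "f = s"
        using in_H[OF *(1-3)] f FG_0 by simp
      then show ?thesis
        using *(1) by blast
    qed
  next
    fix f assume "f \<in> Domain S"
    then show "f \<in> Domain T \<inter> H"
      using S_T operator_inD(1)[OF S(1)] by blast
  qed
  have dom_H1: "Domain T \<inter> H1 = {0}"
  proof (intro equalityI subsetI)
    fix f assume f: "f \<in> Domain T \<inter> H1"
    then obtain g where "(f, g) \<in> T" by blast
    then show "f \<in> {0}"
      by (rule T_E) (use in_H1 f in simp)
  next
    fix f :: 'a assume "f \<in> {0}"
    then show "f \<in> Domain T \<inter> H1"
      using operator_inD(3)[OF op] H1s(4) by blast
  qed
  show thesis
    by (rule that[OF op sym ran_plus ran_minus S_T dom_H dom_H1])
qed

theorem theorem9p1:
  fixes H H1 :: "'a :: {complex_hilbert, second_countable_topology} set"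
    and S :: "'a operator"
  assumes "closed_csubspace H"
    and "H1 = UNIV \<ominus> H"
    and "hdim H1 = \<infinity>"
    and "operator_in H S"
    and "densely_defined_in H S"
    and "closed S"
    and "symmetric S"
    and "deficiency_plus H S = \<infinity>"
    and "deficiency_minus H S = \<infinity>"
  shows "(\<exists>T. selfadjoint_in UNIV T \<and> S \<subseteq> T \<and>
            Domain T \<inter> H = Domain S \<and>
            Domain T \<inter> H1 = {0}) \<and>
         (\<exists>T. maximal_dissipative_in UNIV T \<and> densely_defined_in UNIV T \<and> S \<subseteq> T \<and>
            Domain T \<inter> H = Domain S \<and>
            Domain (adjoint_in UNIV T) \<inter> H = Domain S \<and>
            Domain T \<inter> H1 = {0} \<and>
            Domain (adjoint_in UNIV T) \<inter> H1 = {0})"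
proof -
  obtain T where T: "operator_in UNIV T" "symmetric T"
    "Range (add_scalar T \<i>) = UNIV" "Range (add_scalar T (- \<i>)) = UNIV"
    and dom: "S \<subseteq> T" "Domain T \<inter> H = Domain S" "Domain T \<inter> H1 = {0}"
    by (rule exists_symmetric_extension[OF assms])
  have sa: "selfadjoint_in UNIV T"
    using T by (rule selfadjoint_inI)
  then have "densely_defined_in UNIV T" "adjoint_in UNIV T = T"
    by (simp_all add: selfadjoint_in_def)
  moreover have "maximal_dissipative_in UNIV T"
    using T(1-3) by (rule maximal_dissipative_inI)
  ultimately show ?thesis
    using sa dom by (intro conjI exI[of _ T]) simp_all
qed

end
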